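(* Let $\psi : \mathbb{R} \to [0,\infty)$ be a symmetric continuous function (i.e. $\psi(-t) = \psi(t)$ for all $t$). Then $\psi$ is reflection negative with respect to $(\mathbb{R},\mathbb{R}_+,-\mathrm{id}_{\mathbb{R}})$ if and only if $\psi|_{(0,\infty)}$ is a Bernstein function. In particular, this is equivalent to the existence of $a,b \ge 0$ and a positive Borel measure $\mu$ on $(0,\infty)$ with $\int_0^\infty \min(1,\lambda)\, d\mu(\lambda) < \infty$ such that $$\psi(t) = a + b|t| + \int_0^\infty (1 - e^{-\lambda|t|})\, d\mu(\lambda) \qquad \text{for all } t\in\mathbb{R}.$$ Here $a$, $b$ and $\mu$ are uniquely determined by $\psi$.
   Context: $\mathbb{R}_+ = [0,\infty)$. A hermitian kernel $Q : X \times X \to \mathbb{C}$ is negative definite if $\sum_{j,k=1}^n c_j \overline{c_k}\, Q(x_j,x_k) \le 0$ for all $n$, all $x_1,\dots,x_n \in X$ and all $c_1,\dots,c_n \in \mathbb{C}$ with $\sum_j c_j = 0$. A continuous function $\psi : \mathbb{R}\to\mathbb{R}$ is reflection negative with respect to $(\mathbb{R},\mathbb{R}_+,-\mathrm{id}_{\mathbb{R}})$ if the kernel $(\psi(s-t))_{s,t\in\mathbb{R}}$ on $\mathbb{R}$ is negative definite and the kernel $(\psi(s+t))_{s,t \in \mathbb{R}_+}$ on $\mathbb{R}_+$ is negative definite. A smooth function $f : (0,\infty)\to\mathbb{R}$ is completely monotone if $(-1)^k f^{(k)} \ge 0$ for every $k \in \{1,2,\dots\}$. A smooth function $f : (0,\infty)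 \to \mathbb{R}$ is a Bernstein function if $f \ge 0$ and $f'$ is completely monotone. *)

theory Defs
  imports "HOL-Analysis.Analysis" "HOL-Library.Complex_Order"
begin

definition hermitian_kernel_on :: "'a set \<Rightarrow> ('a \<Rightarrow> 'a \<Rightarrow> complex) \<Rightarrow> bool" where
  "hermitian_kernel_on X Q \<longleftrightarrow> (\<forall>x\<in>X. \<forall>y\<in>X. Q y x = cnj (Q x y))"

text \<open>
  The comparison with 0 is the order of Complex_Order: it says that the sum is real and
  nonpositive.  The points need not be distinct.
\<close>

definition negative_definite_kernel_on :: "'a set \<Rightarrow> ('a \<Rightarrow> 'a \<Rightarrow> complex) \<Rightarrow> bool" where
  "negative_definite_kernel_on X Q \<longleftrightarrow>
     hermitian_kernel_on X Q \<and>
     (\<forall>n. \<forall>x :: nat \<Rightarrow> 'a. \<forall>c :: nat \<Rightarrow> complex.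
        (\<forall>j\<in>{1..n}. x j \<in> X) \<longrightarrow> (\<Sum>j = 1..n. c j) = 0 \<longrightarrow>
        (\<Sum>j = 1..n. \<Sum>k = 1..n. c j * cnj (c k) * Q (x j) (x k)) \<le> 0)"

text \<open>
  Reflection negativity with respect to the triple consisting of the group \<open>\<real>\<close>, the
  semigroup \<open>[0,\<infinity>)\<close> and the involution \<open>t \<mapsto> -t\<close>.
\<close>

definition reflection_negative :: "(real \<Rightarrow> real) \<Rightarrow> bool" where
  "reflection_negative \<psi> \<longleftrightarrow>
     continuous_on UNIV \<psi> \<and>
     negative_definite_kernel_on UNIV (\<lambda>s t. complex_of_real (\<psi> (s - t))) \<and>
     negative_definite_kernel_on {0..} (\<lambda>s t. complex_of_real (\<psi> (s + t)))"

text \<open>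
  A function on \<open>(0,\<infinity>)\<close> is represented by a total function on the reals.  As \<open>(0,\<infinity>)\<close> is
  open, the iterated derivatives there depend only on the values on \<open>(0,\<infinity>)\<close>, so the three
  predicates below speak about the restriction to \<open>(0,\<infinity>)\<close>.
\<close>

definition smooth_on_pos :: "(real \<Rightarrow> real) \<Rightarrow> bool" where
  "smooth_on_pos f \<longleftrightarrow> (\<forall>k. (deriv ^^ k) f differentiable_on {0<..})"

text \<open>
  The order \<open>k = 0\<close> is not part of the condition, so a completely monotone function is not
  required to be nonnegative.  For Bernstein functions this makes no difference: a concave
  function on \<open>(0,\<infinity>)\<close> that is bounded below is nondecreasing.
\<close>

definition completely_monotone :: "(real \<Rightarrow> real) \<Rightarrow> bool" where
  "completely_monotone f \<longleftrightarrow>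
     smooth_on_pos f \<and> (\<forall>k\<ge>1. \<forall>x>0. (- 1) ^ k * (deriv ^^ k) f x \<ge> 0)"

definition bernstein_function :: "(real \<Rightarrow> real) \<Rightarrow> bool" where
  "bernstein_function f \<longleftrightarrow>
     smooth_on_pos f \<and> (\<forall>x>0. f x \<ge> 0) \<and> completely_monotone (deriv f)"

text \<open>
  In the last condition the Bochner integral is never a default value: the integrand is bounded
  by \<open>max 1 \<bar>t\<bar> * min 1 l\<close>, hence integrable by the condition before it.
\<close>

definition levy_khintchine_rep :: "(real \<Rightarrow> real) \<Rightarrow> real \<Rightarrow> real \<Rightarrow> real measure \<Rightarrow> bool" where
  "levy_khintchine_rep \<psi> a b \<mu> \<longleftrightarrow>
     a \<ge> 0 \<and> b \<ge> 0 \<and>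
     sets \<mu> = sets (restrict_space borel {0<..}) \<and>
     (\<integral>\<^sup>+ l. ennreal (min 1 l) \<partial>\<mu>) < \<infinity> \<and>
     (\<forall>t. \<psi> t = a + b * \<bar>t\<bar> + (\<integral> l. (1 - exp (- l * \<bar>t\<bar>)) \<partial>\<mu>))"

end

theory Submission
  imports Defs "HOL-Probability.Levy" "HOL-Real_Asymp.Real_Asymp"
begin

text \<open>
  Everything passes through the sign condition \<open>(-1)\<^sup>n \<Delta>\<^sub>h\<^sup>n \<psi> \<le> 0\<close> on \<open>[0,\<infinity>)\<close> for all \<open>n \<ge> 1\<close> and
  \<open>h > 0\<close>; here \<open>(-1)\<^sup>n \<Delta>\<^sub>h\<^sup>n\<close> is \<open>bdiff h n\<close>.  Reflection negativity implies it: testing the second kernel with \<open>c * (\<delta>\<^sub>h - \<delta>\<^sub>0)\<close> shows that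
  \<open>-\<Delta>\<^sub>h\<^sup>2 \<psi>\<close> is a positive definite function on the semigroup \<open>[0,\<infinity>)\<close>, bounded along \<open>s + \<nat>h\<close>, and
  Cauchy-Schwarz shows that \<open>-\<Delta>\<^sub>h\<close> preserves this class.  A Bernstein function satisfies it by the mean
  value theorem.

  Conversely, the sign condition makes \<open>g(t) = \<psi>(t + 1) - \<psi>(t)\<close> a Hausdorff moment sequence along each
  grid \<open>\<nat>/m\<close>; uniqueness of moments glues these into \<open>g(t) = \<integral> y\<^sup>t d\<nu>(y)\<close> on \<open>[0,1]\<close>.  Then
  \<open>b = \<nu>{1}\<close>, and \<open>\<mu>\<close> is the image of \<open>d\<nu>(y)/(1 - y)\<close> on \<open>(0,1)\<close> under \<open>y \<mapsto> -ln y\<close>.  The difference of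
  \<open>\<psi>\<close> and its representation is 1-periodic, and concavity of \<open>\<psi>\<close> forces it to be constant.
  Uniqueness follows from the moments of the image of \<open>(1 - e\<^sup>-\<^sup>l) d\<mu>(l)\<close> under \<open>l \<mapsto> e\<^sup>-\<^sup>l\<close>.
\<close>

section \<open>Iterated differences\<close>

text \<open>The argument type stays general because the operator acts both on functions of a real
  variable and, with step 1, on sequences over \<open>nat\<close>.\<close>

primrec bdiff :: "'a::plus \<Rightarrow> nat \<Rightarrow> ('a \<Rightarrow> real) \<Rightarrow> 'a \<Rightarrow> real" where
  "bdiff h 0 f t = f t"
| "bdiff h (Suc n) f t = bdiff h n f t - bdiff h n f (t + h)"

lemma bdiff_Suc_shift:
  "bdiff h (Suc n) f t = bdiff h n (\<lambda>u. f u - f (u + h)) t"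
  by (induction n arbitrary: t) auto

lemma bdiff_add: "bdiff h (m + n) f = bdiff h m (bdiff h n f)"
  by (induction m) (auto simp: fun_eq_iff)

lemma bdiff_uminus: "bdiff h n (\<lambda>u. - f u) t = - bdiff h n f t"
  by (induction n arbitrary: t) auto

lemma bdiff_sum_shift:
  fixes h :: "'a::semigroup_add" and a :: "'i \<Rightarrow> 'a"
  assumes "\<And>u. u + h = h + u"
  shows "bdiff h n (\<lambda>u. \<Sum>i\<in>I. f (a i + u)) t = (\<Sum>i\<in>I. bdiff h n f (a i + t))"
  by (induction n arbitrary: t) (auto simp: sum_subtractf add.assoc)

lemma bdiff_grid:
  "bdiff 1 n (\<lambda>k::nat. f (real k * h)) k = bdiff h n f (real k * h)"
  by (induction n arbitrary: k) (auto simp: algebra_simps)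

text \<open>If one step lost an amount \<open>d > 0\<close>, concavity along the progression would
  make every later step lose at least \<open>d\<close>, and \<open>f\<close> would become
  negative.\<close>

lemma bdiff_1_nonpos:
  fixes f :: "real \<Rightarrow> real"
  assumes nonneg: "\<And>t. t \<ge> 0 \<Longrightarrow> f t \<ge> 0" and h: "h \<ge> 0"
    and conc: "\<And>t. t \<ge> 0 \<Longrightarrow> bdiff h 2 f t \<le> 0" and t: "t \<ge> 0"
  shows "bdiff h 1 f t \<le> 0"
proof (rule ccontr)
  define d where "d = f t - f (t + h)"
  assume "\<not> bdiff h 1 f t \<le> 0"
  then have d: "d > 0" by (simp add: d_def)
  have step: "f (t + real k * h) - f (t + real (Suc k) * h) \<ge> d" for k
  proof (induction k)
    case (Suc k)
    have "bdiff h 2 f (t + real k * h) \<le> 0"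
      using conc[of "t + real k * h"] t h by simp
    with Suc show ?case by (simp add: numeral_2_eq_2 algebra_simps)
  qed (simp add: d_def)
  have "f (t + real k * h) \<le> f t - real k * d" for k
  proof (induction k)
    case (Suc k)
    with step[of k] show ?case by (simp add: algebra_simps)
  qed simp
  moreover obtain k where "f t < real k * d"
    using reals_Archimedean3[OF d] by blast
  ultimately have "f (t + real k * h) < 0" by (smt (verit))
  with nonneg[of "t + real k * h"] t h show False by simp
qed

section \<open>Positive definite functions on the half-line\<close>

text \<open>The lists stand for finitely supported signed measures, and \<open>hankel f\<close> is
  the bilinear form with kernel \<open>f (s + t)\<close>. Points may repeat, so appending lists is
  addition of measures.\<close>

definition hankel :: "(real \<Rightarrow> real) \<Rightarrow> (real \<times> real) list \<Rightarrow> (real \<times> real) list \<Rightarrow> real" where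
  "hankel f xs ys = (\<Sum>(c, s)\<leftarrow>xs. \<Sum>(d, t)\<leftarrow>ys. c * d * f (s + t))"

definition scale_pts :: "real \<Rightarrow> (real \<times> real) list \<Rightarrow> (real \<times> real) list" where
  "scale_pts \<alpha> xs = map (\<lambda>(c, s). (\<alpha> * c, s)) xs"

definition shift_pts :: "real \<Rightarrow> (real \<times> real) list \<Rightarrow> (real \<times> real) list" where
  "shift_pts h xs = map (\<lambda>(c, s). (c, s + h)) xs"

lemma hankel_append_left: "hankel f (xs @ ys) zs = hankel f xs zs + hankel f ys zs"
  by (simp add: hankel_def)

lemma hankel_append_right: "hankel f zs (xs @ ys) = hankel f zs xs + hankel f zs ys"
  by (simp add: hankel_def sum_list_addf case_prod_unfold)

lemma hankel_scale_left: "hankel f (scale_pts \<alpha> xs) ys = \<alpha> * hankel f xs ys"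
  by (simp add: hankel_def scale_pts_def case_prod_unfold comp_def sum_list_const_mult mult.assoc)

lemma hankel_scale_right: "hankel f xs (scale_pts \<alpha> ys) = \<alpha> * hankel f xs ys"
  by (simp add: hankel_def scale_pts_def case_prod_unfold comp_def mult.assoc mult.left_commute[of _ \<alpha>]
       flip: sum_list_const_mult)

lemma hankel_shift_left: "hankel f (shift_pts h xs) ys = hankel (\<lambda>u. f (u + h)) xs ys"
  by (simp add: hankel_def shift_pts_def case_prod_unfold comp_def ac_simps)

lemma hankel_shift_right: "hankel f xs (shift_pts h ys) = hankel (\<lambda>u. f (u + h)) xs ys"
  by (simp add: hankel_def shift_pts_def case_prod_unfold comp_def ac_simps)

lemma hankel_diff: "hankel (\<lambda>u. f u - g u) xs ys = hankel f xs ys - hankel g xs ys"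
  by (simp add: hankel_def case_prod_unfold sum_list_subtractf right_diff_distrib)

lemma hankel_mult: "hankel (\<lambda>u. \<alpha> * f u) xs ys = \<alpha> * hankel f xs ys"
  by (simp add: hankel_def case_prod_unfold mult.left_commute[of _ \<alpha>]
       flip: sum_list_const_mult)

lemmas hankel_simps = hankel_append_left hankel_append_right hankel_scale_left hankel_scale_right
  hankel_shift_left hankel_shift_right

definition nonneg_pts :: "(real \<times> real) list \<Rightarrow> bool" where
  "nonneg_pts xs \<longleftrightarrow> (\<forall>(c, s)\<in>set xs. s \<ge> 0)"

lemma nonneg_pts_simps [simp]:
  "nonneg_pts []"
  "nonneg_pts ((c, s) # xs) \<longleftrightarrow> s \<ge> 0 \<and> nonneg_pts xs"
  "nonneg_pts (xs @ ys) \<longleftrightarrow> nonneg_pts xs \<and> nonneg_pts ys"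
  "nonneg_pts (scale_pts \<alpha> xs) \<longleftrightarrow> nonneg_pts xs"
  by (auto simp: nonneg_pts_def scale_pts_def)

lemma nonneg_pts_shift: "nonneg_pts xs \<Longrightarrow> h \<ge> 0 \<Longrightarrow> nonneg_pts (shift_pts h xs)"
  by (auto simp: nonneg_pts_def shift_pts_def)

definition pos_hankel :: "(real \<Rightarrow> real) \<Rightarrow> bool" where
  "pos_hankel f \<longleftrightarrow> (\<forall>xs. nonneg_pts xs \<longrightarrow> hankel f xs xs \<ge> 0)"

lemma pos_hankel_nonneg:
  assumes "pos_hankel f" "t \<ge> 0"
  shows "f t \<ge> 0"
proof -
  have "hankel f [(1, t / 2)] [(1, t / 2)] \<ge> 0"
    using assms by (simp add: pos_hankel_def)
  then show ?thesis by (simp add: hankel_def)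
qed

text \<open>Only finitely many progressions \<open>s + t + n * h\<close> occur for fixed lists, so
  bounds that depend on the starting point combine into one.\<close>

lemma hankel_bounded_shift:
  assumes bdd: "\<And>s. s \<ge> 0 \<Longrightarrow> \<exists>B. \<forall>n. \<bar>f (s + real n * h)\<bar> \<le> B"
    and "nonneg_pts xs" "nonneg_pts ys"
  shows "\<exists>B. \<forall>n. \<bar>hankel (\<lambda>u. f (u + real n * h)) xs ys\<bar> \<le> B"
  using assms(2)
proof (induction xs)
  case Nil
  show ?case by (auto simp: hankel_def)
next
  case (Cons x xs)
  obtain c s where x: "x = (c, s)" by (cases x)
  have s: "s \<ge> 0" using Cons.prems by (simp add: x)
  have "\<exists>B. \<forall>n. \<bar>\<Sum>(d, t)\<leftarrow>ys. c * d * f (s + t + real n * h)\<bar> \<le> B"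
    using assms(3)
  proof (induction ys)
    case (Cons y ys)
    obtain d t where y: "y = (d, t)" by (cases y)
    have "t \<ge> 0" using Cons.prems by (simp add: y)
    then obtain B1 where B1: "\<And>n. \<bar>f (s + t + real n * h)\<bar> \<le> B1"
      using bdd[of "s + t"] s by auto
    obtain B2 where B2: "\<And>n. \<bar>\<Sum>(d, t)\<leftarrow>ys. c * d * f (s + t + real n * h)\<bar> \<le> B2"
      using Cons by (auto simp: y)
    have "\<bar>\<Sum>(d, t)\<leftarrow>(y # ys). c * d * f (s + t + real n * h)\<bar> \<le> \<bar>c * d\<bar> * B1 + B2" for n
    proof -
      have "\<bar>c * d * f (s + t + real n * h)\<bar> \<le> \<bar>c * d\<bar> * B1"
        unfolding abs_mult[of "c * d"] by (intro mult_left_mono B1) auto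
      with B2[of n] show ?thesis by (simp add: y)
    qed
    then show ?case by blast
  qed auto
  then obtain B1 where B1: "\<And>n. \<bar>\<Sum>(d, t)\<leftarrow>ys. c * d * f (s + t + real n * h)\<bar> \<le> B1"
    by blast
  obtain B2 where B2: "\<And>n. \<bar>hankel (\<lambda>u. f (u + real n * h)) xs ys\<bar> \<le> B2"
    using Cons by (auto simp: x)
  have "\<bar>hankel (\<lambda>u. f (u + real n * h)) (x # xs) ys\<bar> \<le> B1 + B2" for n
    using B1[of n] B2[of n] by (simp add: hankel_def x)
  then show ?case by blast
qed

lemma pos_quadratic_discriminant:
  fixes a b c :: real
  assumes "\<And>x y. a * x\<^sup>2 + 2 * b * x * y + c * y\<^sup>2 \<ge> 0"
  shows "b\<^sup>2 \<le> a * c"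
proof (cases "a = 0")
  case True
  have "b = 0"
  proof (rule ccontr)
    assume "b \<noteq> 0"
    \<comment> \<open>At this \<open>x\<close> and \<open>y = 1\<close> the form equals
      \<open>- (c + 1) + c = - 1\<close>.\<close>
    then show False
      using assms[of "- (c + 1) / (2 * b)" 1] by (simp add: True)
  qed
  then show ?thesis by (simp add: True)
next
  case False
  have "a \<ge> 0" using assms[of 1 0] by simp
  \<comment> \<open>The choice \<open>x = - b\<close>, \<open>y = a\<close> turns the form into
    exactly this product.\<close>
  moreover have "a * (a * c - b\<^sup>2) \<ge> 0"
    using assms[of "- b" a] by (simp add: power2_eq_square algebra_simps)
  ultimately show ?thesis using False by (simp add: zero_le_mult_iff)
qed

text \<open>
  The Cauchy-Schwarz inequality \<open>F(h)\<^sup>2 \<le> F(0) F(2h)\<close> for \<open>F(t) = hankel (f(\<cdot> + t))\<close> can be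
  iterated: if \<open>F(h) > F(0)\<close> held, \<open>F(2\<^sup>n h)\<close> would grow without bound.
\<close>

lemma pos_hankel_bdiff_1:
  assumes pos: "pos_hankel f" and h: "h \<ge> 0"
    and bdd: "\<And>s. s \<ge> 0 \<Longrightarrow> \<exists>B. \<forall>n. \<bar>f (s + real n * h)\<bar> \<le> B"
  shows "pos_hankel (\<lambda>t. f t - f (t + h))"
  unfolding pos_hankel_def
proof (intro allI impI)
  fix xs assume xs: "nonneg_pts xs"
  define F where "F t = hankel (\<lambda>u. f (u + t)) xs xs" for t
  have CS: "(F t)\<^sup>2 \<le> F 0 * F (2 * t)" if t: "t \<ge> 0" for t
  proof (rule pos_quadratic_discriminant)
    fix \<alpha> \<beta> :: real
    \<comment> \<open>A combination of the measure and its translate by \<open>t\<close>; its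
      quadratic form is the binary form in \<open>\<alpha>\<close> and
      \<open>\<beta>\<close>.\<close>
    define ys where "ys = scale_pts \<alpha> xs @ scale_pts \<beta> (shift_pts t xs)"
    have "nonneg_pts ys" by (simp add: ys_def xs nonneg_pts_shift t)
    then have "hankel f ys ys \<ge> 0" using pos by (simp add: pos_hankel_def)
    also have "hankel f ys ys = F 0 * \<alpha>\<^sup>2 + 2 * F t * \<alpha> * \<beta> + F (2 * t) * \<beta>\<^sup>2"
      by (simp add: ys_def hankel_simps F_def power2_eq_square algebra_simps)
    finally show "F 0 * \<alpha>\<^sup>2 + 2 * F t * \<alpha> * \<beta> + F (2 * t) * \<beta>\<^sup>2 \<ge> 0" .
  qed
  have F0: "F 0 \<ge> 0" using pos xs by (simp add: pos_hankel_def F_def)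
  have "F h \<le> F 0"
  proof (cases "F 0 = 0")
    case True
    then show ?thesis using CS[OF h] by simp
  next
    case False
    with F0 have F0: "F 0 > 0" by simp
    show ?thesis
    proof (rule ccontr)
      assume "\<not> F h \<le> F 0"
      define \<epsilon> where "\<epsilon> = F h / F 0 - 1"
      have \<epsilon>: "\<epsilon> > 0" using \<open>\<not> F h \<le> F 0\<close> F0 by (simp add: \<epsilon>_def field_simps)
      \<comment> \<open>Linear growth in \<open>n\<close> is enough: squaring at least doubles the
        excess of the ratio over 1.\<close>
      have grow: "F (2 ^ n * h) / F 0 \<ge> 1 + real n * \<epsilon>" for n
      proof (induction n)
        case 0
        show ?case using \<epsilon> F0 by (simp add: \<epsilon>_def field_simps)
      next
        case (Suc n)
        show ?case
        \<comment> \<open>At \<open>n = 0\<close> the induction hypothesis only gives the lower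
          bound 1, so the exact ratio \<open>1 + \<epsilon>\<close> is squared instead.\<close>
        proof (cases "n = 0")
          case True
          have "(1 + \<epsilon>)\<^sup>2 = (F h / F 0)\<^sup>2" by (simp add: \<epsilon>_def)
          also have "\<dots> \<le> F (2 * h) / F 0"
            using CS[OF h] F0 by (simp add: power_divide power2_eq_square field_simps)
          finally show ?thesis
            using \<epsilon> True by (simp add: power2_eq_square algebra_simps) (smt (verit) mult_pos_pos)
        next
          case False
          have "(1 + real n * \<epsilon>)\<^sup>2 \<le> (F (2 ^ n * h) / F 0)\<^sup>2"
            using Suc \<epsilon> by (intro power_mono) auto
          also have "\<dots> \<le> F (2 * (2 ^ n * h)) / F 0"
            using CS[of "2 ^ n * h"] h F0 by (simp add: power_divide power2_eq_square field_simps)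
          finally have "1 + 2 * (real n * \<epsilon>) + (real n * \<epsilon>)\<^sup>2 \<le> F (2 * (2 ^ n * h)) / F 0"
            by (simp add: power2_eq_square algebra_simps)
          moreover have "real n * \<epsilon> \<ge> \<epsilon>" using False \<epsilon> by simp
          moreover have "(real n * \<epsilon>)\<^sup>2 \<ge> 0" by simp
          ultimately have "1 + real n * \<epsilon> + \<epsilon> \<le> F (2 * (2 ^ n * h)) / F 0" by linarith
          then show ?thesis by (simp add: algebra_simps)
        qed
      qed
      obtain B where B: "\<And>n. \<bar>F (real n * h)\<bar> \<le> B"
        using hankel_bounded_shift[OF bdd xs xs] unfolding F_def by blast
      have "real n * \<epsilon> \<le> B / F 0" for n
      proof -
        have "real n * \<epsilon> \<le> F (2 ^ n * h) / F 0" using grow[of n] by simp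
        also have "\<dots> \<le> B / F 0"
          using B[of "2 ^ n"] F0 by (intro divide_right_mono) auto
        finally show ?thesis .
      qed
      moreover obtain n where "B / F 0 < real n * \<epsilon>"
        using reals_Archimedean3[OF \<epsilon>] by blast
      ultimately show False by (smt (verit))
    qed
  qed
  then show "hankel (\<lambda>t. f t - f (t + h)) xs xs \<ge> 0"
    by (simp add: hankel_diff F_def)
qed

text \<open>Boundedness is carried through the induction together with positivity: the new
  difference and the subtracted value are both nonnegative, hence the new difference lies between 0
  and the old one.\<close>

lemma pos_hankel_bdiff:
  assumes pos: "pos_hankel f" and h: "h \<ge> 0"
    and bdd: "\<And>s. s \<ge> 0 \<Longrightarrow> \<exists>B. \<forall>n. \<bar>f (s + real n * h)\<bar> \<le> B"
  shows "pos_hankel (bdiff h n f)"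
proof -
  have "pos_hankel (bdiff h n f) \<and> (\<forall>s\<ge>0. \<exists>B. \<forall>k. \<bar>bdiff h n f (s + real k * h)\<bar> \<le> B)"
  proof (induction n)
    case 0
    show ?case using pos bdd by simp
  next
    case (Suc n)
    then have pos': "pos_hankel (\<lambda>t. bdiff h n f t - bdiff h n f (t + h))"
      by (intro pos_hankel_bdiff_1 h) auto
    moreover have "\<exists>B. \<forall>k. \<bar>bdiff h (Suc n) f (s + real k * h)\<bar> \<le> B" if s: "s \<ge> 0" for s
    proof -
      obtain B where B: "\<And>k. \<bar>bdiff h n f (s + real k * h)\<bar> \<le> B"
        using Suc s by blast
      have "\<bar>bdiff h (Suc n) f (s + real k * h)\<bar> \<le> B" for k
      proof -
        have "s + real k * h \<ge> 0" using s h by simp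
        then have "bdiff h (Suc n) f (s + real k * h) \<ge> 0"
          "bdiff h n f (s + real k * h + h) \<ge> 0"
          using pos_hankel_nonneg[OF pos', of "s + real k * h"]
            pos_hankel_nonneg[of "bdiff h n f" "s + real k * h + h"] Suc h by auto
        with B[of k] show ?thesis by simp
      qed
      then show ?thesis by blast
    qed
    moreover have "bdiff h (Suc n) f = (\<lambda>t. bdiff h n f t - bdiff h n f (t + h))"
      by (simp add: fun_eq_iff)
    ultimately show ?case by simp
  qed
  then show ?thesis ..
qed

section \<open>Differences of a reflection negative function\<close>

lemma negative_definite_hankel:
  assumes nd: "negative_definite_kernel_on {0..} (\<lambda>s t. complex_of_real (f (s + t)))"
    and xs: "nonneg_pts xs" and sum: "(\<Sum>(c, s)\<leftarrow>xs. c) = 0"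
  shows "hankel f xs xs \<le> 0"
proof -
  define n where "n = length xs"
  define c where "c j = fst (xs ! (j - 1))" for j
  define x where "x j = snd (xs ! (j - 1))" for j
  have sum_list: "(\<Sum>p\<leftarrow>xs. g p) = (\<Sum>j=1..n. g (c j, x j))" for g :: "real \<times> real \<Rightarrow> real"
  proof -
    have "(\<Sum>p\<leftarrow>xs. g p) = (\<Sum>i=0..<n. g (xs ! i))"
      by (simp add: sum_list_sum_nth n_def)
    also have "\<dots> = (\<Sum>j=1..n. g (xs ! (j - 1)))"
      by (rule sum.reindex_bij_witness[of _ "\<lambda>j. j - 1" Suc]) auto
    finally show ?thesis by (simp add: c_def x_def)
  qed
  have c0: "(\<Sum>j=1..n. complex_of_real (c j)) = 0"
    using sum sum_list[of fst] by (simp add: case_prod_unfold flip: of_real_sum)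
  have "\<forall>j\<in>{1..n}. x j \<in> {0..}"
  proof
    fix j assume "j \<in> {1..n}"
    then have "xs ! (j - 1) \<in> set xs" by (auto simp: n_def)
    with xs show "x j \<in> {0..}" by (auto simp: nonneg_pts_def x_def case_prod_unfold)
  qed
  with nd c0 have "(\<Sum>j=1..n. \<Sum>k=1..n. complex_of_real (c j) * cnj (complex_of_real (c k)) *
      complex_of_real (f (x j + x k))) \<le> 0"
    unfolding negative_definite_kernel_on_def by blast
  also have "(\<Sum>j=1..n. \<Sum>k=1..n. complex_of_real (c j) * cnj (complex_of_real (c k)) *
      complex_of_real (f (x j + x k))) = complex_of_real (\<Sum>j=1..n. \<Sum>k=1..n. c j * c k * f (x j + x k))"
    by simp
  finally have "(\<Sum>j=1..n. \<Sum>k=1..n. c j * c k * f (x j + x k)) \<le> 0"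
    unfolding less_eq_complex_def by simp
  then show ?thesis
    by (simp add: hankel_def sum_list case_prod_unfold)
qed

lemma reflection_negative_bdiff_nonpos:
  fixes f :: "real \<Rightarrow> real"
  assumes nonneg: "\<And>t. t \<ge> 0 \<Longrightarrow> f t \<ge> 0" and h: "h \<ge> 0"
    and nd: "negative_definite_kernel_on {0..} (\<lambda>s t. complex_of_real (f (s + t)))"
    and t: "t \<ge> 0" and n: "n \<ge> 1"
  shows "bdiff h n f t \<le> 0"
proof -
  define \<phi> where "\<phi> u = - bdiff h 2 f u" for u
  have \<phi>_eq: "\<phi> u = 2 * f (u + h) - f u - f (u + 2 * h)" for u
    by (simp add: \<phi>_def numeral_2_eq_2 algebra_simps)
  have pos: "pos_hankel \<phi>"
    unfolding pos_hankel_def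
  proof (intro allI impI)
    fix xs assume xs: "nonneg_pts xs"
    define ys where "ys = scale_pts (-1) xs @ shift_pts h xs"
    have neg: "(\<Sum>p\<leftarrow>xs. - fst p) + (\<Sum>p\<leftarrow>xs. fst p) = 0" for xs :: "(real \<times> real) list"
      by (induction xs) auto
    have "nonneg_pts ys" by (simp add: ys_def xs nonneg_pts_shift h)
    moreover have "(\<Sum>(c, s)\<leftarrow>ys. c) = 0"
      by (simp add: ys_def scale_pts_def shift_pts_def case_prod_unfold comp_def neg)
    ultimately have "hankel f ys ys \<le> 0" by (rule negative_definite_hankel[OF nd])
    \<comment> \<open>The four blocks of \<open>ys\<close> add up to the second difference of
      \<open>f\<close>; the factor -1 is split off so that \<open>hankel_mult\<close>
      applies.\<close>
    also have "hankel f ys ys = hankel (\<lambda>u. - 1 * \<phi> u) xs xs"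
      by (simp add: ys_def hankel_simps \<phi>_eq hankel_diff hankel_mult add.assoc)
    finally show "hankel \<phi> xs xs \<ge> 0" unfolding hankel_mult by simp
  qed
  have conc: "bdiff h 2 f u \<le> 0" if "u \<ge> 0" for u
    using pos_hankel_nonneg[OF pos that] by (simp add: \<phi>_def)
  have mono: "bdiff h 1 f u \<le> 0" if "u \<ge> 0" for u
    by (rule bdiff_1_nonpos[OF nonneg h conc that])
  \<comment> \<open>\<open>\<phi>\<close> is the drop of the increment \<open>g\<close> over one
    step. Increments are nonnegative and decrease along the progression, so no drop exceeds
    \<open>g s\<close>.\<close>
  have "\<exists>B. \<forall>n. \<bar>\<phi> (s + real n * h)\<bar> \<le> B" if s: "s \<ge> 0" for s
  proof -
    define g where "g u = f (u + h) - f u" for u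
    have \<phi>_g: "\<phi> u = g u - g (u + h)" for u by (simp add: g_def \<phi>_eq algebra_simps)
    have g_nonneg: "g u \<ge> 0" if "u \<ge> 0" for u using mono[OF that] by (simp add: g_def)
    have g_le: "g (s + real n * h) \<le> g s" for n
    proof (induction n)
      case (Suc n)
      have "\<phi> (s + real n * h) \<ge> 0" using pos_hankel_nonneg[OF pos] s h by simp
      with Suc show ?case unfolding \<phi>_g by (simp add: algebra_simps)
    qed simp
    have "\<bar>\<phi> (s + real n * h)\<bar> \<le> g s" for n
    proof -
      have "s + real n * h \<ge> 0" using s h by simp
      then have "\<phi> (s + real n * h) \<ge> 0" "g (s + real n * h + h) \<ge> 0"
        using h by (simp_all only: pos_hankel_nonneg[OF pos] g_nonneg add_nonneg_nonneg)
      with g_le[of n] show ?thesis unfolding \<phi>_g by simp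
    qed
    then show ?thesis by blast
  qed
  then have "pos_hankel (bdiff h m \<phi>)" for m
    by (rule pos_hankel_bdiff[OF pos h])
  then have "bdiff h m \<phi> t \<ge> 0" for m by (rule pos_hankel_nonneg) fact
  moreover have "bdiff h m \<phi> t = - bdiff h (m + 2) f t" for m
    unfolding \<phi>_def bdiff_uminus bdiff_add ..
  ultimately have ge2: "bdiff h (m + 2) f t \<le> 0" for m by (metis neg_0_le_iff_le)
  show ?thesis
  proof (cases "n = 1")
    case False
    with n have "n - 2 + 2 = n" by simp
    with ge2[of "n - 2"] show ?thesis by (simp only:)
  qed (use mono[OF t] in simp)
qed

section \<open>Differences of Bernstein functions\<close>

text \<open>Taking one difference of the whole tower \<open>\<Phi>\<close> lowers the order by one;
  the mean value theorem passes the sign of the derivative of order \<open>Suc n\<close> to the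
  derivative of order \<open>n\<close> of the differenced tower.\<close>

lemma bdiff_nonpos_of_derivatives:
  fixes \<Phi> :: "nat \<Rightarrow> real \<Rightarrow> real"
  assumes "\<And>k x. x > 0 \<Longrightarrow> (\<Phi> k has_real_derivative \<Phi> (Suc k) x) (at x)"
    and "\<And>x. x > 0 \<Longrightarrow> (- 1) ^ n * \<Phi> n x \<le> 0" and h: "h > 0" and "t > 0"
  shows "bdiff h n (\<Phi> 0) t \<le> 0"
  using assms(1,2,4)
proof (induction n arbitrary: \<Phi> t)
  case (Suc n)
  define \<Psi> where "\<Psi> k x = \<Phi> k x - \<Phi> k (x + h)" for k x
  have "bdiff h n (\<Psi> 0) t \<le> 0"
  proof (rule Suc.IH)
    fix k and x :: real assume x: "x > 0"
    have "((\<lambda>x. \<Phi> k (x + h)) has_real_derivative \<Phi> (Suc k) (x + h)) (at x)"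
      using Suc.prems(1)[of "x + h" k] x h by (simp add: DERIV_shift)
    then show "(\<Psi> k has_real_derivative \<Psi> (Suc k) x) (at x)"
      unfolding \<Psi>_def by (intro DERIV_diff Suc.prems x)
  next
    fix x :: real assume x: "x > 0"
    obtain z where z: "x < z" "\<Phi> n (x + h) - \<Phi> n x = (x + h - x) * \<Phi> (Suc n) z"
      using MVT2[of x "x + h" "\<Phi> n" "\<Phi> (Suc n)"] Suc.prems(1) x h by force
    then have "(- 1) ^ n * \<Psi> n x = h * ((- 1) ^ Suc n * \<Phi> (Suc n) z)"
      by (simp add: \<Psi>_def algebra_simps flip: right_diff_distrib)
    also have "\<dots> \<le> 0"
    proof (rule mult_nonneg_nonpos)
      show "(- 1) ^ Suc n * \<Phi> (Suc n) z \<le> 0" by (rule Suc.prems(2)) (use z x in simp)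
    qed (use h in simp)
    finally show "(- 1) ^ n * \<Psi> n x \<le> 0" .
  qed (fact Suc.prems)
  then show ?case unfolding bdiff_Suc_shift \<Psi>_def .
qed simp

lemma continuous_on_bdiff:
  fixes f :: "real \<Rightarrow> real"
  assumes "continuous_on UNIV f"
  shows "continuous_on UNIV (bdiff h n f)"
proof (induction n)
  case (Suc n)
  have "continuous_on UNIV (\<lambda>t. bdiff h n f t - bdiff h n f (t + h))"
    by (intro continuous_intros Suc continuous_on_compose2[OF Suc]) auto
  then show ?case by simp
qed (use assms in simp)

text \<open>Complete monotonicity of the derivative controls the derivatives of \<open>f\<close> of
  order at least 2, hence the differences of these orders. The first difference then follows from
  concavity and nonnegativity.\<close>

lemma bernstein_function_bdiff_nonpos:
  assumes f: "bernstein_function f" and cont: "continuous_on UNIV f"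
    and h: "h > 0" and t: "t \<ge> 0" and n: "n \<ge> 1"
  shows "bdiff h n f t \<le> 0"
proof -
  \<comment> \<open>The derivatives give the sign for \<open>t > 0\<close> only; continuity carries
    it to \<open>t = 0\<close>.\<close>
  have closure: "bdiff h n f t \<le> 0" if "\<And>t. t > 0 \<Longrightarrow> bdiff h n f t \<le> 0" "t \<ge> 0" for n t
  proof (cases "t = 0")
    case True
    have "(bdiff h n f \<longlongrightarrow> bdiff h n f 0) (at_right 0)"
      using continuous_on_bdiff[OF cont] by (simp add: continuous_on_def tendsto_within_subset[of _ _ _ UNIV])
    moreover have "\<forall>\<^sub>F t in at_right 0. bdiff h n f t \<le> 0"
      using that(1) by (auto simp: eventually_at_filter)
    ultimately show ?thesis
      unfolding True by (rule tendsto_upperbound) simp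
  qed (use that in auto)
  have der: "((deriv ^^ k) f has_real_derivative (deriv ^^ Suc k) f x) (at x)" if "x > 0" for k x
  proof -
    have "(deriv ^^ k) f differentiable (at x)"
      using f that unfolding bernstein_function_def smooth_on_pos_def differentiable_on_def
      by (metis at_within_open greaterThan_iff open_greaterThan)
    then show ?thesis by (simp add: DERIV_deriv_iff_real_differentiable)
  qed
  have ge2: "bdiff h n f t \<le> 0" if n: "n \<ge> 2" and t: "t \<ge> 0" for n t
  proof (rule closure[OF _ t])
    fix t :: real assume "t > 0"
    obtain m where m: "n = Suc m" "m \<ge> 1" using n by (cases n) auto
    have "(- 1) ^ n * (deriv ^^ n) f x \<le> 0" if "x > 0" for x
    proof -
      have "(- 1) ^ m * (deriv ^^ m) (deriv f) x \<ge> 0"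
        using f m that unfolding bernstein_function_def completely_monotone_def by blast
      then show ?thesis by (simp only: m funpow_Suc_right comp_def) simp
    qed
    with der h \<open>t > 0\<close> have "bdiff h n ((deriv ^^ 0) f) t \<le> 0"
      by (intro bdiff_nonpos_of_derivatives[where \<Phi> = "\<lambda>k. (deriv ^^ k) f"])
    then show "bdiff h n f t \<le> 0" by simp
  qed
  have nonneg: "f t \<ge> 0" if "t \<ge> 0" for t
  proof (cases "t = 0")
    case True
    have "(f \<longlongrightarrow> f 0) (at_right 0)"
      using cont by (simp add: continuous_on_def tendsto_within_subset[of _ _ _ UNIV])
    moreover have "\<forall>\<^sub>F t in at_right 0. f t \<ge> 0"
      using f by (auto simp: eventually_at_filter bernstein_function_def)
    ultimately show ?thesis
      unfolding True by (rule tendsto_lowerbound) simp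
  qed (use that f in \<open>auto simp: bernstein_function_def\<close>)
  show ?thesis
  proof (cases "n = 1")
    case True
    show ?thesis unfolding True
      by (rule bdiff_1_nonpos) (use nonneg h ge2 t in auto)
  qed (use ge2 n t in auto)
qed

section \<open>Negative definiteness of Levy-Khintchine representations\<close>

text \<open>Split the coefficients into real and imaginary parts: each part has sum zero, and the
  mixed terms cancel because the kernel is symmetric.\<close>

lemma negative_definite_kernel_onI_real:
  assumes sym: "\<And>x y. x \<in> X \<Longrightarrow> y \<in> X \<Longrightarrow> Q y x = Q x y"
    and nd: "\<And>n x c. (\<And>j. j \<in> {1..n} \<Longrightarrow> x j \<in> X) \<Longrightarrow> (\<Sum>j=1..n::nat. c j) = (0::real) \<Longrightarrow>
      (\<Sum>j=1..n. \<Sum>k=1..n. c j * c k * Q (x j) (x k)) \<le> 0"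
  shows "negative_definite_kernel_on X (\<lambda>x y. complex_of_real (Q x y))"
  unfolding negative_definite_kernel_on_def
proof (intro conjI allI impI)
  show "hermitian_kernel_on X (\<lambda>x y. complex_of_real (Q x y))"
    using sym by (auto simp: hermitian_kernel_on_def)
next
  fix n :: nat and x :: "nat \<Rightarrow> 'a" and c :: "nat \<Rightarrow> complex"
  assume x: "\<forall>j\<in>{1..n}. x j \<in> X" and c: "(\<Sum>j=1..n. c j) = 0"
  define S where "S = (\<Sum>j=1..n. \<Sum>k=1..n. c j * cnj (c k) * complex_of_real (Q (x j) (x k)))"
  have "Re S = (\<Sum>j=1..n. \<Sum>k=1..n. Re (c j) * Re (c k) * Q (x j) (x k)) +
      (\<Sum>j=1..n. \<Sum>k=1..n. Im (c j) * Im (c k) * Q (x j) (x k))"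
    by (simp add: S_def distrib_right flip: sum.distrib)
  moreover have "(\<Sum>j=1..n. Re (c j)) = 0" "(\<Sum>j=1..n. Im (c j)) = 0"
    using c by (simp_all flip: Re_sum Im_sum)
  ultimately have "Re S \<le> 0" using nd[of n x] x by (simp add: add_nonpos_nonpos)
  moreover have "Im S = 0"
  proof -
    define A where "A = (\<Sum>j=1..n. \<Sum>k=1..n. Im (c j) * Re (c k) * Q (x j) (x k))"
    have "A = (\<Sum>j=1..n. \<Sum>k=1..n. Re (c j) * Im (c k) * Q (x j) (x k))"
      unfolding A_def by (subst sum.swap) (intro sum.cong refl, use x sym in \<open>auto simp: mult.commute\<close>)
    moreover have "Im S = A - (\<Sum>j=1..n. \<Sum>k=1..n. Re (c j) * Im (c k) * Q (x j) (x k))"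
      by (simp add: S_def A_def algebra_simps flip: sum_subtractf)
    ultimately show ?thesis by simp
  qed
  ultimately show "S \<le> 0" by (simp add: less_eq_complex_def)
qed

section \<open>Elementary kernels: minimum, exponential and absolute value\<close>

lemma integral_double_sum:
  fixes g :: "'i \<Rightarrow> 'i \<Rightarrow> 'a \<Rightarrow> real"
  assumes "\<And>j k. j \<in> I \<Longrightarrow> k \<in> I \<Longrightarrow> integrable M (g j k)"
  shows "(\<integral>x. (\<Sum>j\<in>I. \<Sum>k\<in>I. c j * c k * g j k x) \<partial>M) = (\<Sum>j\<in>I. \<Sum>k\<in>I. c j * c k * (\<integral>x. g j k x \<partial>M))"
  using assms by (simp add: Bochner_Integration.integral_sum cong: sum.cong)

text \<open>\<open>min (p j) (p k)\<close> is the L2 inner product of the indicators of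
  \<open>{0..p j}\<close> and \<open>{0..p k}\<close>, so this is a Gram form.\<close>

lemma min_kernel_nonneg:
  fixes p w :: "'i \<Rightarrow> real"
  assumes p: "\<And>j. j \<in> I \<Longrightarrow> p j \<ge> 0"
  shows "(\<Sum>j\<in>I. \<Sum>k\<in>I. w j * w k * min (p j) (p k)) \<ge> 0"
proof -
  have ind: "(\<integral>x. indicator {0..p j} x * indicator {0..p k} x \<partial>lborel) = min (p j) (p k)"
    "integrable lborel (\<lambda>x. indicator {0..p j} x * indicator {0..p k} x :: real)"
    if "j \<in> I" "k \<in> I" for j k
  proof -
    have "indicator {0..p j} x * indicator {0..p k} x = (indicator {0..min (p j) (p k)} x :: real)" for x
      by (auto simp: indicator_def)
    then show "(\<integral>x. indicator {0..p j} x * indicator {0..p k} x \<partial>lborel) = min (p j) (p k)"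
      "integrable lborel (\<lambda>x. indicator {0..p j} x * indicator {0..p k} x :: real)"
      using p that by auto
  qed
  have "0 \<le> (\<integral>x. (\<Sum>j\<in>I. w j * indicator {0..p j} x)\<^sup>2 \<partial>lborel)"
    by (rule Bochner_Integration.integral_nonneg) simp
  also have "\<dots> = (\<integral>x. (\<Sum>j\<in>I. \<Sum>k\<in>I. w j * w k * (indicator {0..p j} x * indicator {0..p k} x)) \<partial>lborel)"
    by (simp add: power2_eq_square sum_product ac_simps)
  also have "\<dots> = (\<Sum>j\<in>I. \<Sum>k\<in>I. w j * w k * (\<integral>x. indicator {0..p j} x * indicator {0..p k} x \<partial>lborel))"
    by (rule integral_double_sum) (rule ind)
  also have "\<dots> = (\<Sum>j\<in>I. \<Sum>k\<in>I. w j * w k * min (p j) (p k))"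
    by (intro sum.cong refl) (simp add: ind)
  finally show ?thesis .
qed

text \<open>This is a rescaled minimum kernel: pulling out
  \<open>exp (- l * s) * exp (- l * t)\<close> leaves the minimum of \<open>exp (2 * l * s)\<close>
  and \<open>exp (2 * l * t)\<close>.\<close>

lemma exp_abs_kernel_nonneg:
  fixes x c :: "'i \<Rightarrow> real"
  assumes "l \<ge> 0"
  shows "(\<Sum>j\<in>I. \<Sum>k\<in>I. c j * c k * exp (- l * \<bar>x j - x k\<bar>)) \<ge> 0"
proof -
  have "exp (- l * \<bar>s - t\<bar>) = exp (- l * s) * exp (- l * t) * min (exp (2 * l * s)) (exp (2 * l * t))" for s t
  proof (cases "s \<le> t")
    case True
    then have "l * s \<le> l * t" using assms by (intro mult_left_mono)
    with True show ?thesis by (simp add: min_def algebra_simps flip: exp_add)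
  next
    case False
    then have "l * t \<le> l * s" using assms by (intro mult_left_mono) auto
    with False show ?thesis by (simp add: min_def algebra_simps flip: exp_add)
  qed
  then have "(\<Sum>j\<in>I. \<Sum>k\<in>I. c j * c k * exp (- l * \<bar>x j - x k\<bar>)) =
      (\<Sum>j\<in>I. \<Sum>k\<in>I. (c j * exp (- l * x j)) * (c k * exp (- l * x k)) *
        min (exp (2 * l * x j)) (exp (2 * l * x k)))"
    by (simp add: ac_simps)
  also have "\<dots> \<ge> 0" by (rule min_kernel_nonneg) simp
  finally show ?thesis .
qed

lemma double_sum_add_eq_0:
  fixes c u v :: "'i \<Rightarrow> real"
  assumes "(\<Sum>j\<in>I. c j) = 0"
  shows "(\<Sum>j\<in>I. \<Sum>k\<in>I. c j * c k * (u j + v k)) = 0"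
proof -
  have "(\<Sum>j\<in>I. \<Sum>k\<in>I. c j * c k * (u j + v k)) =
      (\<Sum>j\<in>I. \<Sum>k\<in>I. (c j * u j) * c k) + (\<Sum>j\<in>I. \<Sum>k\<in>I. c j * (c k * v k))"
    by (simp add: algebra_simps flip: sum.distrib)
  then show ?thesis by (simp add: assms flip: sum_product)
qed

text \<open>\<open>\<bar>x - y\<bar> = x + y - 2 * min x y\<close>, and the additive part vanishes
  against coefficients of sum zero. Translation by \<open>m\<close> makes the points nonnegative, as
  the minimum kernel requires, and keeps distances.\<close>

lemma abs_kernel_nonpos:
  fixes x c :: "'i \<Rightarrow> real"
  assumes I: "finite I" and c: "(\<Sum>j\<in>I. c j) = 0"
  shows "(\<Sum>j\<in>I. \<Sum>k\<in>I. c j * c k * \<bar>x j - x k\<bar>) \<le> 0"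
proof -
  define m where "m = (\<Sum>j\<in>I. \<bar>x j\<bar>)"
  define p where "p j = x j + m" for j
  have "p j \<ge> 0" if "j \<in> I" for j
    using member_le_sum[OF that, of "\<lambda>j. \<bar>x j\<bar>"] I unfolding p_def m_def by simp
  then have "(\<Sum>j\<in>I. \<Sum>k\<in>I. c j * c k * min (p j) (p k)) \<ge> 0" by (rule min_kernel_nonneg)
  moreover have "c j * c k * \<bar>x j - x k\<bar> = c j * c k * (p j + p k) - 2 * (c j * c k * min (p j) (p k))" for j k
    by (simp add: p_def min_def algebra_simps)
  then have "(\<Sum>j\<in>I. \<Sum>k\<in>I. c j * c k * \<bar>x j - x k\<bar>) =
      (\<Sum>j\<in>I. \<Sum>k\<in>I. c j * c k * (p j + p k)) - 2 * (\<Sum>j\<in>I. \<Sum>k\<in>I. c j * c k * min (p j) (p k))"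
    by (simp only: sum_subtractf sum_distrib_left)
  ultimately show ?thesis by (simp add: double_sum_add_eq_0[OF c])
qed

section \<open>Integrals against a Levy measure\<close>

locale levy_measure =
  fixes \<mu> :: "real measure"
  assumes sets_levy: "sets \<mu> = sets (restrict_space borel {0<..})"
    and nn_integral_min: "(\<integral>\<^sup>+ l. ennreal (min 1 l) \<partial>\<mu>) < \<infinity>"
begin

lemma space_levy: "space \<mu> = {0<..}"
  using sets_eq_imp_space_eq[OF sets_levy] by (simp add: space_restrict_space)

lemma measurable_levy: "f \<in> borel_measurable borel \<Longrightarrow> f \<in> borel_measurable \<mu>"
  unfolding measurable_cong_sets[OF sets_levy refl] by (rule measurable_restrict_space1)

lemma integrable_levy:
  fixes f :: "real \<Rightarrow> real"
  assumes f: "f \<in> borel_measurable borel" and le: "\<And>l. l > 0 \<Longrightarrow> \<bar>f l\<bar> \<le> C * min 1 l"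
  shows "integrable \<mu> f"
proof (rule Bochner_Integration.integrable_bound)
  have "integrable \<mu> (min 1)"
    by (rule integrableI_nonneg) (use nn_integral_min in \<open>auto intro: measurable_levy AE_I2 simp: space_levy\<close>)
  then show "integrable \<mu> (\<lambda>l. C * min 1 l)" by simp
  show "AE l in \<mu>. norm (f l) \<le> norm (C * min 1 l)"
    by (rule AE_I2) (use le in \<open>fastforce simp: space_levy\<close>)
qed (rule measurable_levy[OF f])

lemma integrable_one_minus_exp:
  assumes "t \<ge> 0"
  shows "integrable \<mu> (\<lambda>l. 1 - exp (- l * t))"
proof (rule integrable_levy)
  fix l :: real assume l: "l > 0"
  have "1 - exp (- l * t) \<le> l * t" using exp_ge_add_one_self[of "- l * t"] by simp
  also have "\<dots> \<le> max 1 t * l" using l by (simp add: mult.commute)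
  finally have "1 - exp (- l * t) \<le> max 1 t * l" .
  moreover have "1 - exp (- l * t) \<le> max 1 t * 1" by (simp add: max.coboundedI1 less_imp_le)
  moreover have "exp (- l * t) \<le> 1" using l assms by simp
  ultimately show "\<bar>1 - exp (- l * t)\<bar> \<le> max 1 t * min 1 l" by (simp add: min_def)
qed simp

definition levy_integral :: "real \<Rightarrow> real" where
  "levy_integral t = (\<integral>l. (1 - exp (- l * t)) \<partial>\<mu>)"

lemma levy_integral_0: "levy_integral 0 = 0"
  by (simp add: levy_integral_def)

text \<open>Against coefficients of sum zero the constant in
  \<open>1 - exp (- l * \<tau> j k)\<close> drops out, so for each \<open>l\<close> the form is
  minus a nonnegative one.\<close>

lemma levy_integral_nonpos:
  fixes \<tau> :: "'i \<Rightarrow> 'i \<Rightarrow> real"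
  assumes \<tau>: "\<And>j k. j \<in> I \<Longrightarrow> k \<in> I \<Longrightarrow> \<tau> j k \<ge> 0" and c: "(\<Sum>j\<in>I. c j) = 0"
    and pd: "\<And>l. l > 0 \<Longrightarrow> (\<Sum>j\<in>I. \<Sum>k\<in>I. c j * c k * exp (- l * \<tau> j k)) \<ge> 0"
  shows "(\<Sum>j\<in>I. \<Sum>k\<in>I. c j * c k * levy_integral (\<tau> j k)) \<le> 0"
proof -
  have "(\<Sum>j\<in>I. \<Sum>k\<in>I. c j * c k * levy_integral (\<tau> j k)) =
      (\<integral>l. (\<Sum>j\<in>I. \<Sum>k\<in>I. c j * c k * (1 - exp (- l * \<tau> j k))) \<partial>\<mu>)"
    unfolding levy_integral_def
    by (rule integral_double_sum[symmetric]) (intro integrable_one_minus_exp \<tau>)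
  moreover have "0 \<le> (\<integral>l. - (\<Sum>j\<in>I. \<Sum>k\<in>I. c j * c k * (1 - exp (- l * \<tau> j k))) \<partial>\<mu>)"
  proof (rule integral_nonneg_AE, rule AE_I2)
    fix l assume "l \<in> space \<mu>"
    then have l: "l > 0" by (simp add: space_levy)
    have "(\<Sum>j\<in>I. \<Sum>k\<in>I. c j * c k * (1 - exp (- l * \<tau> j k))) =
        (\<Sum>j\<in>I. c j) * (\<Sum>j\<in>I. c j) - (\<Sum>j\<in>I. \<Sum>k\<in>I. c j * c k * exp (- l * \<tau> j k))"
      by (simp add: right_diff_distrib sum_subtractf sum_product)
    with pd[OF l] c show "0 \<le> - (\<Sum>j\<in>I. \<Sum>k\<in>I. c j * c k * (1 - exp (- l * \<tau> j k)))" by simp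
  qed
  ultimately show ?thesis by simp
qed

text \<open>The abstract \<open>\<tau>\<close> covers both kernels of reflection negativity:
  \<open>\<bar>x - y\<bar>\<close> on the line and \<open>x + y\<close> on the half-line.\<close>

lemma negative_definite_levy:
  assumes \<tau>: "\<And>x y. x \<in> X \<Longrightarrow> y \<in> X \<Longrightarrow> \<tau> x y \<ge> 0" "\<And>x y. \<tau> y x = \<tau> x y" and b: "b \<ge> 0"
    and nd: "\<And>n x c. (\<And>j. j \<in> {1..n::nat} \<Longrightarrow> x j \<in> X) \<Longrightarrow> (\<Sum>j=1..n. c j) = (0::real) \<Longrightarrow>
      (\<Sum>j=1..n. \<Sum>k=1..n. c j * c k * \<tau> (x j) (x k)) \<le> 0"
    and pd: "\<And>l n x c. l > 0 \<Longrightarrow> (\<And>j. j \<in> {1..n::nat} \<Longrightarrow> x j \<in> X) \<Longrightarrow>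
      (\<Sum>j=1..n. \<Sum>k=1..n. c j * c k * exp (- l * \<tau> (x j) (x k))) \<ge> (0::real)"
  shows "negative_definite_kernel_on X
    (\<lambda>x y. complex_of_real (a + b * \<tau> x y + levy_integral (\<tau> x y)))"
proof (rule negative_definite_kernel_onI_real)
  fix n :: nat and x :: "nat \<Rightarrow> 'a" and c :: "nat \<Rightarrow> real"
  assume x: "\<And>j. j \<in> {1..n} \<Longrightarrow> x j \<in> X" and c: "(\<Sum>j=1..n. c j) = 0"
  have "(\<Sum>j=1..n. \<Sum>k=1..n. c j * c k * (a + b * \<tau> (x j) (x k) + levy_integral (\<tau> (x j) (x k)))) =
      a * ((\<Sum>j=1..n. c j) * (\<Sum>j=1..n. c j)) +
      b * (\<Sum>j=1..n. \<Sum>k=1..n. c j * c k * \<tau> (x j) (x k)) +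
      (\<Sum>j=1..n. \<Sum>k=1..n. c j * c k * levy_integral (\<tau> (x j) (x k)))"
    by (simp add: sum_product sum_distrib_left sum.distrib distrib_left ac_simps)
  also have "\<dots> \<le> 0"
  proof -
    have "b * (\<Sum>j=1..n. \<Sum>k=1..n. c j * c k * \<tau> (x j) (x k)) \<le> 0"
      by (intro mult_nonneg_nonpos b nd x c)
    moreover have "(\<Sum>j=1..n. \<Sum>k=1..n. c j * c k * levy_integral (\<tau> (x j) (x k))) \<le> 0"
      by (rule levy_integral_nonpos) (use \<tau> x c pd in auto)
    ultimately show ?thesis using c by simp
  qed
  finally show "(\<Sum>j=1..n. \<Sum>k=1..n. c j * c k *
      (a + b * \<tau> (x j) (x k) + levy_integral (\<tau> (x j) (x k)))) \<le> 0" .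
qed (simp add: \<tau>)

lemma exp_diff_kernel_integrable:
  assumes "s \<ge> 0" "t \<ge> 0"
  shows "integrable \<mu> (\<lambda>l. exp (- l * t) * (1 - exp (- l * s)))"
    and "levy_integral (t + s) - levy_integral t = (\<integral>l. exp (- l * t) * (1 - exp (- l * s)) \<partial>\<mu>)"
proof -
  have eq: "exp (- l * t) * (1 - exp (- l * s)) = (1 - exp (- l * (t + s))) - (1 - exp (- l * t))" for l
    by (simp add: algebra_simps flip: exp_add)
  show "integrable \<mu> (\<lambda>l. exp (- l * t) * (1 - exp (- l * s)))"
    unfolding eq by (intro Bochner_Integration.integrable_diff integrable_one_minus_exp) (use assms in auto)
  show "levy_integral (t + s) - levy_integral t = (\<integral>l. exp (- l * t) * (1 - exp (- l * s)) \<partial>\<mu>)"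
    unfolding eq levy_integral_def
    by (intro Bochner_Integration.integral_diff[symmetric] integrable_one_minus_exp) (use assms in auto)
qed

lemma levy_integral_increment_bounds:
  assumes "0 \<le> s" "s \<le> 1" "t \<ge> 0"
  shows "0 \<le> levy_integral (t + s) - levy_integral t"
    and "levy_integral (t + s) - levy_integral t \<le> levy_integral (t + 1) - levy_integral t"
proof -
  have le: "exp (- l) \<le> exp (- l * s)" "exp (- l * s) \<le> 1" if "l \<in> space \<mu>" for l
    using that assms by (auto simp: space_levy mult_left_le)
  show "0 \<le> levy_integral (t + s) - levy_integral t"
    unfolding exp_diff_kernel_integrable(2)[OF assms(1,3)]
    by (rule integral_nonneg_AE, rule AE_I2) (use le in auto)
  show "levy_integral (t + s) - levy_integral t \<le> levy_integral (t + 1) - levy_integral t"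
    unfolding exp_diff_kernel_integrable(2)[OF assms(1,3)] exp_diff_kernel_integrable(2)[OF zero_le_one assms(3)]
    by (rule integral_mono) (use le assms exp_diff_kernel_integrable(1)[of s t] exp_diff_kernel_integrable(1)[of 1 t] in auto)
qed

text \<open>Hence the unit increments of a represented function tend to its slope \<open>b\<close>.
  The integrands are dominated by the integrable \<open>1 - exp (- l)\<close>.\<close>

lemma levy_integral_increment_tendsto_0:
  "(\<lambda>n. levy_integral (real n + 1) - levy_integral (real n)) \<longlonglongrightarrow> 0"
proof -
  have "(\<lambda>n. \<integral>l. exp (- l * real n) * (1 - exp (- l * 1)) \<partial>\<mu>) \<longlonglongrightarrow> (\<integral>l. 0 \<partial>\<mu>)"
  proof (rule integral_dominated_convergence)
    show "integrable \<mu> (\<lambda>l. 1 - exp (- l * 1))" by (rule integrable_one_minus_exp) simp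
    show "AE l in \<mu>. (\<lambda>n. exp (- l * real n) * (1 - exp (- l * 1))) \<longlonglongrightarrow> 0"
    proof (rule AE_I2)
      fix l assume "l \<in> space \<mu>"
      then have "l > 0" by (simp add: space_levy)
      then show "(\<lambda>n. exp (- l * real n) * (1 - exp (- l * 1))) \<longlonglongrightarrow> 0" by real_asymp
    qed
    show "AE l in \<mu>. norm (exp (- l * real n) * (1 - exp (- l * 1))) \<le> 1 - exp (- l * 1)" for n
      by (rule AE_I2) (auto simp: space_levy abs_mult mult_left_le_one_le)
  qed (auto intro!: measurable_levy)
  then show ?thesis by (simp only: exp_diff_kernel_integrable(2)[OF zero_le_one of_nat_0_le_iff]) simp
qed

text \<open>The exponent starts at 1 because \<open>\<mu>\<close> may have infinite mass near 0,
  where one factor \<open>l\<close> is needed. For \<open>l > 1\<close> a single term of the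
  exponential series gives the bound.\<close>

lemma integrable_power_exp:
  assumes t: "t > 0"
  shows "integrable \<mu> (\<lambda>l. l ^ Suc k * exp (- l * t))"
proof (rule integrable_levy)
  fix l :: real assume l: "l > 0"
  define C where "C = fact (Suc k) / t ^ Suc k"
  have C: "C \<ge> 0" using t by (simp add: C_def)
  have bound: "l ^ Suc k * exp (- l * t) \<le> (1 + C) * min 1 l"
  proof (cases "l \<le> 1")
    case True
    have "l ^ Suc k * exp (- l * t) \<le> l * 1"
      using l t True by (intro mult_mono) (auto simp: power_le_one mult_left_le)
    also have "\<dots> \<le> (1 + C) * l" using C l by (simp add: distrib_right)
    finally show ?thesis using True by (simp add: min_def)
  next
    case False
    have "(\<Sum>m\<in>{Suc k}. (l * t) ^ m /\<^sub>R fact m) \<le> exp (l * t)"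
      unfolding exp_def using l t
      by (intro sum_le_suminf summable_exp_generic) (auto simp del: power_Suc)
    then have "(l * t) ^ Suc k \<le> exp (l * t) * fact (Suc k)"
      by (simp add: field_simps del: power_Suc fact_Suc)
    then have "l ^ Suc k * exp (- l * t) \<le> C"
      using t by (simp add: C_def exp_minus field_simps power_mult_distrib del: power_Suc fact_Suc)
    with False show ?thesis by (simp add: min_def)
  qed
  then show "\<bar>l ^ Suc k * exp (- l * t)\<bar> \<le> (1 + C) * min 1 l"
    using l by (simp add: abs_mult)
qed simp

end

lemma levy_khintchine_rep_iff:
  "levy_khintchine_rep \<psi> a b \<mu> \<longleftrightarrow> a \<ge> 0 \<and> b \<ge> 0 \<and> levy_measure \<mu> \<and>
     (\<forall>t. \<psi> t = a + b * \<bar>t\<bar> + levy_measure.levy_integral \<mu> \<bar>t\<bar>)"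
proof (cases "levy_measure \<mu>")
  case True
  then show ?thesis
    by (simp add: levy_khintchine_rep_def levy_measure.levy_integral_def levy_measure_def)
qed (auto simp: levy_khintchine_rep_def levy_measure_def)

lemma levy_khintchine_imp_reflection_negative:
  assumes rep: "levy_khintchine_rep \<psi> a b \<mu>" and cont: "continuous_on UNIV \<psi>"
  shows "reflection_negative \<psi>"
proof -
  interpret levy_measure \<mu> using rep by (simp add: levy_khintchine_rep_iff)
  have b: "b \<ge> 0" and \<psi>: "\<psi> t = a + b * \<bar>t\<bar> + levy_integral \<bar>t\<bar>" for t
    using rep by (simp_all add: levy_khintchine_rep_iff)
  have "negative_definite_kernel_on UNIV (\<lambda>s t. complex_of_real (\<psi> (s - t)))"
    unfolding \<psi>
  proof (rule negative_definite_levy)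
    fix n :: nat and x c :: "nat \<Rightarrow> real"
    show "(\<Sum>j=1..n. c j) = 0 \<Longrightarrow> (\<Sum>j=1..n. \<Sum>k=1..n. c j * c k * \<bar>x j - x k\<bar>) \<le> 0"
      by (rule abs_kernel_nonpos) auto
    show "l > 0 \<Longrightarrow> (\<Sum>j=1..n. \<Sum>k=1..n. c j * c k * exp (- l * \<bar>x j - x k\<bar>)) \<ge> 0" for l
      by (rule exp_abs_kernel_nonneg) auto
  qed (use b in auto)
  \<comment> \<open>On the half-line \<open>\<bar>s + t\<bar> = s + t\<close>; the exponential
    kernel then factorises and its form is a square.\<close>
  moreover have "negative_definite_kernel_on {0..} (\<lambda>s t. complex_of_real (a + b * (s + t) + levy_integral (s + t)))"
  proof (rule negative_definite_levy)
    fix l :: real and n :: nat and x c :: "nat \<Rightarrow> real"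
    have "(\<Sum>j=1..n. \<Sum>k=1..n. c j * c k * exp (- l * (x j + x k))) =
        (\<Sum>j=1..n. c j * exp (- l * x j)) * (\<Sum>j=1..n. c j * exp (- l * x j))"
      by (simp add: sum_product distrib_left exp_diff exp_minus divide_inverse ac_simps)
    then show "(\<Sum>j=1..n. \<Sum>k=1..n. c j * c k * exp (- l * (x j + x k))) \<ge> 0" by simp
  qed (use b in \<open>auto simp: double_sum_add_eq_0\<close>)
  then have "negative_definite_kernel_on {0..} (\<lambda>s t. complex_of_real (\<psi> (s + t)))"
    by (simp add: \<psi> negative_definite_kernel_on_def hermitian_kernel_on_def cong: conj_cong)
  ultimately show ?thesis using cont by (simp add: reflection_negative_def)
qed

section \<open>Smoothness of Levy-Khintchine representations\<close>

text \<open>A remainder of size \<open>h\<^sup>2 * K x\<close> with \<open>K\<close> integrable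
  survives integration, so the difference quotient deviates from the integral of \<open>D\<close> by
  at most \<open>\<bar>h\<bar> * \<kappa>\<close>.\<close>

lemma has_real_derivative_integral:
  fixes F :: "real \<Rightarrow> 'a \<Rightarrow> real"
  assumes e: "e > 0" and F: "\<And>h. \<bar>h\<bar> < e \<Longrightarrow> integrable M (F (t + h))"
    and D: "integrable M D" and K: "integrable M K"
    and bound: "\<And>h x. \<bar>h\<bar> < e \<Longrightarrow> x \<in> space M \<Longrightarrow> \<bar>F (t + h) x - F t x - h * D x\<bar> \<le> h\<^sup>2 * K x"
  shows "((\<lambda>t. \<integral>x. F t x \<partial>M) has_real_derivative (\<integral>x. D x \<partial>M)) (at t)"
proof -
  define G where "G t = (\<integral>x. F t x \<partial>M)" for t
  define d where "d = (\<integral>x. D x \<partial>M)"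
  define \<kappa> where "\<kappa> = (\<integral>x. K x \<partial>M)"
  have Ft: "integrable M (F t)" using F[of 0] e by simp
  have quot: "norm ((G (t + h) - G t) / h - d) \<le> \<bar>h\<bar> * \<kappa>" if h: "\<bar>h\<bar> < e" "h \<noteq> 0" for h
  proof -
    have "G (t + h) - G t - h * d = (\<integral>x. F (t + h) x - F t x - h * D x \<partial>M)"
      using F[OF h(1)] Ft D by (simp add: G_def d_def)
    also have "norm \<dots> \<le> (\<integral>x. norm (F (t + h) x - F t x - h * D x) \<partial>M)"
      by (rule integral_norm_bound)
    also have "\<dots> \<le> (\<integral>x. h\<^sup>2 * K x \<partial>M)"
      using F[OF h(1)] Ft D K bound[OF h(1)] by (intro integral_mono) auto
    finally have "\<bar>G (t + h) - G t - h * d\<bar> \<le> \<bar>h\<bar> * (\<bar>h\<bar> * \<kappa>)"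
      by (simp add: \<kappa>_def power2_eq_square)
    moreover have "(G (t + h) - G t) / h - d = (G (t + h) - G t - h * d) / h"
      using h by (simp add: field_simps)
    ultimately show ?thesis
      using h by (simp add: abs_divide pos_divide_le_eq mult.commute mult.left_commute)
  qed
  have "(\<lambda>h. (G (t + h) - G t) / h - d) \<midarrow>0\<rightarrow> 0"
  proof (rule Lim_null_comparison)
    show "\<forall>\<^sub>F h in at 0. norm ((G (t + h) - G t) / h - d) \<le> \<bar>h\<bar> * \<kappa>"
      using e quot by (auto simp: eventually_at dist_real_def)
    have "((\<lambda>h. \<bar>h\<bar> * \<kappa>) \<longlongrightarrow> \<bar>0\<bar> * \<kappa>) (at 0)" by (intro tendsto_intros)
    then show "((\<lambda>h. \<bar>h\<bar> * \<kappa>) \<longlongrightarrow> 0) (at 0)" by simp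
  qed
  then show ?thesis
    unfolding DERIV_def G_def[symmetric] d_def[symmetric] by (rule LIM_zero_cancel)
qed

text \<open>Taylor's formula of order 2 with an intermediate exponent. The restriction on
  \<open>h\<close> keeps the total exponent at most \<open>- l * (t / 2)\<close>, so the bound still
  decays in \<open>l\<close>.\<close>

lemma exp_taylor_bound:
  fixes l t h :: real
  assumes l: "l > 0" and h: "\<bar>h\<bar> < t / 2"
  shows "\<bar>exp (- l * (t + h)) - exp (- l * t) - h * (- l * exp (- l * t))\<bar>
    \<le> h\<^sup>2 * (l\<^sup>2 * exp (- l * (t / 2)))"
proof -
  define u where "u = - l * h"
  obtain s where s: "\<bar>s\<bar> \<le> \<bar>u\<bar>" "exp u = (\<Sum>m<2. u ^ m / fact m) + exp s / fact 2 * u ^ 2"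
    using Maclaurin_exp_le[of u 2] by blast
  have lin: "exp u - 1 - u = exp s / 2 * u\<^sup>2"
    using s(2) by (simp add: numeral_2_eq_2)
  have "\<bar>u\<bar> \<le> l * (t / 2)" using l h by (simp add: u_def abs_mult)
  with s(1) have s_le: "s - l * t \<le> - l * (t / 2)" by (simp add: algebra_simps)
  have "exp (- l * (t + h)) - exp (- l * t) - h * (- l * exp (- l * t)) = exp (- l * t) * (exp u - 1 - u)"
    by (simp add: u_def algebra_simps flip: exp_add)
  also have "\<dots> = exp (s - l * t) / 2 * u\<^sup>2"
    unfolding lin by (simp add: exp_diff exp_minus field_simps)
  finally have "\<bar>exp (- l * (t + h)) - exp (- l * t) - h * (- l * exp (- l * t))\<bar> = exp (s - l * t) / 2 * u\<^sup>2"
    by (simp only:) (simp add: abs_mult)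
  also have "exp (s - l * t) / 2 \<le> exp (s - l * t)" by simp
  also have "\<dots> \<le> exp (- l * (t / 2))" using s_le by (simp only: exp_le_cancel_iff)
  finally show ?thesis by (simp add: u_def power_mult_distrib ac_simps mult_right_mono)
qed

context levy_measure
begin

text \<open>For \<open>k \<ge> 1\<close> and \<open>t > 0\<close> this is, up to sign, the
  derivative of order \<open>k\<close> of \<open>levy_integral\<close>. At \<open>k = 0\<close> an
  infinite \<open>\<mu>\<close> yields the default value 0.\<close>

definition levy_moment :: "nat \<Rightarrow> real \<Rightarrow> real" where
  "levy_moment k t = (\<integral>l. l ^ k * exp (- l * t) \<partial>\<mu>)"

lemma levy_moment_nonneg: "levy_moment k t \<ge> 0"
  unfolding levy_moment_def by (rule integral_nonneg_AE, rule AE_I2) (simp add: space_levy)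

lemma has_real_derivative_levy_integral:
  assumes t: "t > 0"
  shows "(levy_integral has_real_derivative levy_moment 1 t) (at t)"
  unfolding levy_integral_def[abs_def] levy_moment_def
proof (rule has_real_derivative_integral[where e = "t / 2" and K = "\<lambda>l. l ^ Suc 1 * exp (- l * (t / 2))"])
  fix h l assume h: "\<bar>h\<bar> < t / 2" and "l \<in> space \<mu>"
  then have "l > 0" by (simp add: space_levy)
  from exp_taylor_bound[OF this h]
  show "\<bar>1 - exp (- l * (t + h)) - (1 - exp (- l * t)) - h * (l ^ 1 * exp (- l * t))\<bar>
      \<le> h\<^sup>2 * (l ^ Suc 1 * exp (- l * (t / 2)))"
    by (simp add: power2_eq_square abs_minus_commute algebra_simps abs_if split: if_splits)
next
  show "integrable \<mu> (\<lambda>l. l ^ 1 * exp (- l * t))"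
    using integrable_power_exp[OF t, of 0] by simp
  show "integrable \<mu> (\<lambda>l. l ^ Suc 1 * exp (- l * (t / 2)))"
    using t by (intro integrable_power_exp) simp
  show "integrable \<mu> (\<lambda>l. 1 - exp (- l * (t + h)))" if "\<bar>h\<bar> < t / 2" for h
    using that t by (intro integrable_one_minus_exp) (simp add: abs_less_iff)
qed (use t in simp)

lemma has_real_derivative_levy_moment:
  assumes t: "t > 0"
  shows "(levy_moment (Suc k) has_real_derivative - levy_moment (Suc (Suc k)) t) (at t)"
proof -
  have "((\<lambda>t. \<integral>l. l ^ Suc k * exp (- l * t) \<partial>\<mu>) has_real_derivative
      (\<integral>l. - (l ^ Suc (Suc k) * exp (- l * t)) \<partial>\<mu>)) (at t)"
  proof (rule has_real_derivative_integral[where e = "t / 2" and K = "\<lambda>l. l ^ Suc (Suc (Suc k)) * exp (- l * (t / 2))"])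
    fix h l assume h: "\<bar>h\<bar> < t / 2" and "l \<in> space \<mu>"
    then have l: "l > 0" by (simp add: space_levy)
    have "l ^ Suc k * exp (- l * (t + h)) - l ^ Suc k * exp (- l * t) - h * - (l ^ Suc (Suc k) * exp (- l * t)) =
        l ^ Suc k * (exp (- l * (t + h)) - exp (- l * t) - h * (- l * exp (- l * t)))"
      by (simp add: algebra_simps)
    also have "\<bar>\<dots>\<bar> \<le> l ^ Suc k * (h\<^sup>2 * (l\<^sup>2 * exp (- l * (t / 2))))"
      using exp_taylor_bound[OF l h] l by (simp add: abs_mult del: power_Suc mult_minus_left)
    also have "\<dots> = h\<^sup>2 * (l ^ Suc (Suc (Suc k)) * exp (- l * (t / 2)))"
      by (simp add: power2_eq_square)
    finally show "\<bar>l ^ Suc k * exp (- l * (t + h)) - l ^ Suc k * exp (- l * t) - h * - (l ^ Suc (Suc k) * exp (- l * t))\<bar>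
        \<le> h\<^sup>2 * (l ^ Suc (Suc (Suc k)) * exp (- l * (t / 2)))" .
  next
    show "integrable \<mu> (\<lambda>l. - (l ^ Suc (Suc k) * exp (- l * t)))"
      by (intro Bochner_Integration.integrable_minus integrable_power_exp t)
    show "integrable \<mu> (\<lambda>l. l ^ Suc (Suc (Suc k)) * exp (- l * (t / 2)))"
      using t by (intro integrable_power_exp) simp
    show "integrable \<mu> (\<lambda>l. l ^ Suc k * exp (- l * (t + h)))" if "\<bar>h\<bar> < t / 2" for h
      using that t by (intro integrable_power_exp) (simp add: abs_less_iff)
  qed (use t in simp)
  then show ?thesis unfolding levy_moment_def[abs_def] by simp
qed

end

text \<open>Since the half-line is open, values at \<open>x > 0\<close> alone fix the derivatives
  there; so a tower of functions that differentiate into each other gives all iterated derivatives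
  of \<open>f\<close>.\<close>

lemma funpow_deriv_eq:
  fixes H :: "nat \<Rightarrow> real \<Rightarrow> real"
  assumes H: "\<And>k x. x > 0 \<Longrightarrow> (H k has_real_derivative H (Suc k) x) (at x)"
    and f: "\<And>x. x > 0 \<Longrightarrow> f x = H 0 x" and x: "x > 0"
  shows "(deriv ^^ k) f x = H k x"
    and "((deriv ^^ k) f has_real_derivative H (Suc k) x) (at x)"
proof -
  have der: "(g has_real_derivative H (Suc k) x) (at x)"
    if "\<And>x. x > 0 \<Longrightarrow> g x = H k x" "x > 0" for g k x
    using that H by (metis greaterThan_iff has_field_derivative_transform_within_open open_greaterThan)
  have eq: "(deriv ^^ k) f x = H k x" if "x > 0" for x k
    using that
  proof (induction k arbitrary: x)
    case (Suc k)
    then show ?case using der[of "(deriv ^^ k) f" k x] by (simp add: DERIV_imp_deriv)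
  qed (use f in simp)
  then show "(deriv ^^ k) f x = H k x" by (simp add: x)
  show "((deriv ^^ k) f has_real_derivative H (Suc k) x) (at x)"
    by (rule der) (use eq x in auto)
qed

lemma levy_khintchine_imp_bernstein:
  assumes rep: "levy_khintchine_rep \<psi> a b \<mu>"
  shows "bernstein_function \<psi>"
proof -
  interpret levy_measure \<mu> using rep by (simp add: levy_khintchine_rep_iff)
  have a: "a \<ge> 0" and b: "b \<ge> 0" and \<psi>: "\<psi> t = a + b * \<bar>t\<bar> + levy_integral \<bar>t\<bar>" for t
    using rep by (simp_all add: levy_khintchine_rep_iff)
  \<comment> \<open>The candidate for the derivative of order \<open>k\<close>: the slope
    \<open>b\<close> survives only in order 1, and from there on every differentiation changes the
    sign.\<close>
  define H where "H k t = (if k = 0 then a + b * t + levy_integral t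
      else (if k = 1 then b else 0) + (- 1) ^ (k - 1) * levy_moment k t)" for k t
  have H: "(H k has_real_derivative H (Suc k) x) (at x)" if x: "x > 0" for k x
  proof (cases k)
    case 0
    show ?thesis unfolding 0 H_def
      by (auto intro!: derivative_eq_intros has_real_derivative_levy_integral x)
  next
    case (Suc m)
    show ?thesis unfolding Suc H_def
      by (auto intro!: derivative_eq_intros has_real_derivative_levy_moment x)
  qed
  have \<psi>_H: "\<psi> x = H 0 x" if "x > 0" for x using that by (simp add: \<psi> H_def)
  have D: "(deriv ^^ k) \<psi> x = H k x" "((deriv ^^ k) \<psi> has_real_derivative H (Suc k) x) (at x)"
    if "x > 0" for k x
    using funpow_deriv_eq[where H = H and f = \<psi>] H \<psi>_H that by blast+
  have diff: "(deriv ^^ k) \<psi> differentiable_on {0<..}" for k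
    unfolding differentiable_on_def
    using D(2) by (metis differentiable_at_withinI greaterThan_iff real_differentiable_def)
  have shift: "(deriv ^^ k) (deriv \<psi>) = (deriv ^^ Suc k) \<psi>" for k
    by (simp only: funpow_Suc_right comp_def)
  have sign: "(- 1) ^ k * (deriv ^^ Suc k) \<psi> x \<ge> 0" if "k \<ge> 1" "x > 0" for k x
  proof -
    have "(- 1) ^ k * H (Suc k) x = ((- 1) ^ k * (- 1) ^ k) * levy_moment (Suc k) x"
      using that by (simp add: H_def)
    then show ?thesis
      unfolding D(1)[OF that(2)] by (simp add: levy_moment_nonneg flip: power_mult_distrib)
  qed
  have "\<psi> x \<ge> 0" if "x > 0" for x
  proof -
    have "levy_integral x \<ge> 0"
      unfolding levy_integral_def using that
      by (intro integral_nonneg_AE AE_I2) (simp add: space_levy)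
    with a b that show ?thesis by (simp add: \<psi>)
  qed
  then show ?thesis
    unfolding bernstein_function_def completely_monotone_def smooth_on_pos_def shift
    using diff sign by blast
qed

section \<open>The Hausdorff moment problem\<close>

text \<open>With \<open>E\<close> the shift, \<open>bdiff 1\<close> iterates \<open>I - E\<close>;
  this is the binomial expansion of \<open>(E + (I - E)) ^ n = I\<close> applied to
  \<open>a\<close>.\<close>

lemma bdiff_binomial_sum:
  fixes a :: "nat \<Rightarrow> real"
  shows "(\<Sum>k\<le>n. real (n choose k) * bdiff 1 (n - k) a (k + j)) = a j"
proof (induction n arbitrary: j)
  case (Suc n)
  have "(\<Sum>k\<le>Suc n. real (Suc n choose k) * bdiff 1 (Suc n - k) a (k + j)) =
      (\<Sum>k\<le>Suc n. real (n choose k) * bdiff 1 (Suc n - k) a (k + j)) +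
      (\<Sum>k\<le>n. real (n choose k) * bdiff 1 (n - k) a (k + j + 1))"
    unfolding sum.atMost_Suc_shift[where n = n]
    by (simp add: sum.distrib algebra_simps)
  also have "(\<Sum>k\<le>Suc n. real (n choose k) * bdiff 1 (Suc n - k) a (k + j)) =
      (\<Sum>k\<le>n. real (n choose k) * bdiff 1 (Suc (n - k)) a (k + j))"
    by (simp add: Suc_diff_le)
  also have "\<dots> + (\<Sum>k\<le>n. real (n choose k) * bdiff 1 (n - k) a (k + j + 1)) =
      (\<Sum>k\<le>n. real (n choose k) * bdiff 1 (n - k) a (k + j))"
    by (simp add: algebra_simps flip: sum.distrib)
  also have "\<dots> = a j" by (rule Suc)
  finally show ?case .
qed simp

text \<open>For a moment sequence this is the integral of the Bernstein polynomial
  \<open>(N choose k) * x ^ k * (1 - x) ^ (N - k)\<close>; it will be the mass placed at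
  \<open>k / N\<close>.\<close>

definition hausdorff_weight :: "(nat \<Rightarrow> real) \<Rightarrow> nat \<Rightarrow> nat \<Rightarrow> real" where
  "hausdorff_weight a N k = real (N choose k) * bdiff 1 (N - k) a k"

text \<open>The product is \<open>(k choose j) / (N choose j)\<close>. Trinomial revision cancels
  the denominator and leaves the binomial expansion of order \<open>N - j\<close>, started at
  \<open>j\<close>.\<close>

lemma hausdorff_weight_moment:
  assumes "j \<le> N"
  shows "(\<Sum>k\<le>N. hausdorff_weight a N k * (\<Prod>i<j. (real k - real i) / (real N - real i))) = a j"
proof -
  define c where "c k = (\<Prod>i<j. (real k - real i) / (real N - real i))" for k
  have c: "c k = real (k choose j) / real (N choose j)" for k
    by (simp add: c_def binomial_gbinomial gbinomial_prod_rev prod_dividef lessThan_atLeast0)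
  have "(\<Sum>k\<le>N. hausdorff_weight a N k * c k) =
      (\<Sum>k=j..N. hausdorff_weight a N k * c k)"
    by (rule sum.mono_neutral_right) (auto simp: c binomial_eq_0)
  also have "\<dots> = (\<Sum>k=j..N. real ((N - j) choose (k - j)) * bdiff 1 (N - k) a k)"
  proof (rule sum.cong[OF refl])
    fix k assume k: "k \<in> {j..N}"
    then have "real (N choose k) * real (k choose j) = real (N choose j) * real ((N - j) choose (k - j))"
      using choose_mult[of j k N] by (simp flip: of_nat_mult)
    moreover have "real (N choose j) \<noteq> 0" using assms by simp
    ultimately have "real (N choose k) * c k = real ((N - j) choose (k - j))"
      by (simp add: c field_simps)
    then show "hausdorff_weight a N k * c k = real ((N - j) choose (k - j)) * bdiff 1 (N - k) a k"
      by (simp add: hausdorff_weight_def mult.commute mult.left_commute)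
  qed
  also have "\<dots> = (\<Sum>k\<le>N - j. real ((N - j) choose k) * bdiff 1 (N - j - k) a (k + j))"
    by (rule sum.reindex_bij_witness[of _ "\<lambda>k. k + j" "\<lambda>k. k - j"]) (use assms in auto)
  also have "\<dots> = a j" by (rule bdiff_binomial_sum)
  finally show ?thesis unfolding c_def .
qed

text \<open>The products are compared factor by factor, with error at most
  \<open>j / (N - j)\<close> each. The condition \<open>2 * j < N\<close> keeps all factors at most
  1 in absolute value, also the negative ones with \<open>k < i\<close>.\<close>

lemma falling_ratio_approx:
  assumes k: "k \<le> N" and N: "2 * j < N"
  shows "\<bar>(\<Prod>i<j. (real k - real i) / (real N - real i)) - (real k / real N) ^ j\<bar>
    \<le> real j * real j / (real N - real j)"
proof -
  have "norm ((\<Prod>i<j. (real k - real i) / (real N - real i)) - (\<Prod>i<j. real k / real N))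
      \<le> (\<Sum>i<j. norm ((real k - real i) / (real N - real i) - real k / real N))"
  proof (rule norm_prod_diff)
    fix i assume "i \<in> {..<j}"
    then have "\<bar>real k - real i\<bar> \<le> real N - real i" "real N - real i > 0"
      using k N by (auto simp: abs_le_iff)
    then show "norm ((real k - real i) / (real N - real i)) \<le> 1"
      by (simp add: abs_divide)
    show "norm (real k / real N) \<le> 1"
      using k N by (simp add: divide_le_eq_1)
  qed
  also have "\<dots> \<le> (\<Sum>i<j. real j / (real N - real j))"
  proof (rule sum_mono)
    fix i assume i: "i \<in> {..<j}"
    then have pos: "real N - real i > 0" "real N > 0" using N by auto
    have "(real k - real i) / (real N - real i) - real k / real N =
        - (real i * (real N - real k) / ((real N - real i) * real N))"
      using pos by (simp add: field_simps)
    then have "norm ((real k - real i) / (real N - real i) - real k / real N) =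
        real i * ((real N - real k) / real N) / (real N - real i)"
      using pos k by (simp add: abs_mult abs_divide)
    also have "\<dots> \<le> real i * 1 / (real N - real i)"
      using pos k by (intro divide_right_mono mult_left_mono) (auto simp: field_simps)
    also have "\<dots> \<le> real j / (real N - real j)"
      using i N by (intro frac_le) auto
    finally show "norm ((real k - real i) / (real N - real i) - real k / real N)
        \<le> real j / (real N - real j)" .
  qed
  finally show ?thesis by simp
qed

text \<open>Powers are unbounded on the line; composed with this retraction onto [0,1] they become
  bounded continuous test functions for weak convergence.\<close>

definition clamp01 :: "real \<Rightarrow> real" where
  "clamp01 x = max 0 (min 1 x)"

lemma clamp01_bounds: "0 \<le> clamp01 x" "clamp01 x \<le> 1"
  and clamp01_id: "0 \<le> x \<Longrightarrow> x \<le> 1 \<Longrightarrow> clamp01 x = x"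
  by (auto simp: clamp01_def)

lemma isCont_clamp01: "isCont clamp01 x"
  unfolding clamp01_def by (intro continuous_intros)

lemma measurable_clamp01 [measurable]: "clamp01 \<in> borel_measurable borel"
  unfolding clamp01_def by measurable

text \<open>The discrete measures with masses \<open>w N k\<close> at \<open>k / N\<close> live on
  [0,1], so a subsequence converges weakly. Their moments of order \<open>j\<close> differ from
  \<open>a j\<close> only through replacing falling ratios by powers, an error that tends to
  0.\<close>

lemma hausdorff_probability:
  assumes pos: "\<And>n k. bdiff 1 n a k \<ge> 0" and a0: "a 0 = (1::real)"
  shows "\<exists>M. real_distribution M \<and> (AE x in M. 0 \<le> x \<and> x \<le> 1) \<and> (\<forall>j. (\<integral>x. x ^ j \<partial>M) = a j)"
proof -
  define w where "w = hausdorff_weight a"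
  have w: "w N k \<ge> 0" for N k using pos[of "N - k" k] by (simp add: w_def hausdorff_weight_def)
  have w_sum: "(\<Sum>k\<le>N. w N k) = 1" for N
    using hausdorff_weight_moment[of 0 N a] by (simp add: w_def a0)
  define \<mu> where "\<mu> n = distr (point_measure {..Suc n} (w (Suc n))) borel (\<lambda>k. real k / real (Suc n))" for n
  have meas: "(\<lambda>k. real k / real (Suc n)) \<in> point_measure {..Suc n} (w (Suc n)) \<rightarrow>\<^sub>M borel" for n
    by simp
  have prob: "prob_space (point_measure {..Suc n} (w (Suc n)))" for n
    by (rule prob_spaceI)
       (simp add: emeasure_point_measure_finite space_point_measure w w_sum flip: sum.atMost_Suc)
  have dist: "real_distribution (\<mu> n)" for n
    unfolding \<mu>_def by (intro prob_space.real_distribution_distr prob meas)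
  have int: "integral\<^sup>L (\<mu> n) g = (\<Sum>k\<le>Suc n. w (Suc n) k * g (real k / real (Suc n)))"
    if "g \<in> borel_measurable borel" for n and g :: "real \<Rightarrow> real"
    unfolding \<mu>_def integral_distr[OF meas that]
    by (simp add: lebesgue_integral_point_measure_finite w del: sum.atMost_Suc)
  have tight: "tight \<mu>"
    unfolding tight_def
  proof (intro conjI allI impI dist)
    fix \<epsilon> :: real assume "\<epsilon> > 0"
    \<comment> \<open>The left end is negative because the half-open interval has to contain the
      point 0.\<close>
    have "measure (\<mu> n) {-1<..1} = 1" for n
    proof -
      have "measure (\<mu> n) {-1<..1} = (\<integral>x. indicator {-1<..1} x \<partial>\<mu> n)"
        by (simp add: \<mu>_def)
      also have "\<dots> = (\<Sum>k\<le>Suc n. w (Suc n) k * indicator {-1<..1} (real k / real (Suc n)))"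
        by (rule int) simp
      also have "\<dots> = (\<Sum>k\<le>Suc n. w (Suc n) k)"
      proof (rule sum.cong[OF refl])
        fix k assume "k \<in> {..Suc n}"
        then have "real k / real (Suc n) \<in> {-1<..1}"
          by (auto simp: field_simps intro: less_le_trans[of _ 0])
        then show "w (Suc n) k * indicator {-1<..1} (real k / real (Suc n)) = w (Suc n) k" by simp
      qed
      finally show ?thesis by (simp only: w_sum)
    qed
    then show "\<exists>a b. a < b \<and> (\<forall>n. 1 - \<epsilon> < measure (\<mu> n) {a<..b})"
      using \<open>\<epsilon> > 0\<close> by (intro exI[of _ "-1"] exI[of _ 1]) auto
  qed
  obtain r M where r: "strict_mono (r :: nat \<Rightarrow> nat)" and M: "real_distribution M"
    and conv: "weak_conv_m (\<mu> \<circ> r) M"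
    using tight_imp_convergent_subsubsequence[OF tight, of id] by (auto simp: strict_mono_def comp_def)
  interpret M: real_distribution M by fact
  have mom: "(\<integral>x. clamp01 x ^ j \<partial>M) = a j" for j
  proof -
    have "(\<lambda>n. integral\<^sup>L ((\<mu> \<circ> r) n) (\<lambda>x. clamp01 x ^ j)) \<longlonglongrightarrow> (\<integral>x. clamp01 x ^ j \<partial>M)"
    proof (rule weak_conv_imp_integral_bdd_continuous_conv[where B = 1])
      show "real_distribution ((\<mu> \<circ> r) n)" for n by (simp add: dist)
      show "isCont (\<lambda>x. clamp01 x ^ j) x" for x
        by (intro continuous_intros isCont_clamp01)
      show "norm (clamp01 x ^ j) \<le> 1" for x
        using clamp01_bounds[of x] by (simp add: power_le_one)
    qed (fact M, fact conv)
    moreover have "(\<lambda>n. integral\<^sup>L (\<mu> n) (\<lambda>x. clamp01 x ^ j)) \<longlonglongrightarrow> a j"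
    proof (rule Lim_transform_eventually[OF Lim_null_comparison[THEN LIM_zero_cancel]])
      show "(\<lambda>n. real j * real j / (real (Suc n) - real j)) \<longlonglongrightarrow> 0"
        by real_asymp
      show "\<forall>\<^sub>F n in sequentially. norm (integral\<^sup>L (\<mu> n) (\<lambda>x. clamp01 x ^ j) - a j)
          \<le> real j * real j / (real (Suc n) - real j)"
        using eventually_gt_at_top[of "2 * j"]
      proof eventually_elim
        fix n assume n: "2 * j < n"
        define N where "N = Suc n"
        define p where "p k = (\<Prod>i<j. (real k - real i) / (real N - real i))" for k
        have clamp: "clamp01 (real k / real N) = real k / real N" if "k \<le> N" for k
          using that by (intro clamp01_id) (auto simp: N_def)
        have "integral\<^sup>L (\<mu> n) (\<lambda>x. clamp01 x ^ j) = (\<Sum>k\<le>N. w N k * clamp01 (real k / real N) ^ j)"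
          unfolding N_def by (rule int) measurable
        also have "\<dots> = (\<Sum>k\<le>N. w N k * (real k / real N) ^ j)"
          by (intro sum.cong refl) (simp add: clamp)
        finally have "integral\<^sup>L (\<mu> n) (\<lambda>x. clamp01 x ^ j) - a j =
            (\<Sum>k\<le>N. w N k * ((real k / real N) ^ j - p k))"
          using hausdorff_weight_moment[of j N a] n
          by (simp add: right_diff_distrib sum_subtractf p_def w_def N_def)
        also have "norm \<dots> \<le> (\<Sum>k\<le>N. w N k * (real j * real j / (real N - real j)))"
        proof (rule sum_norm_le)
          fix k assume "k \<in> {..N}"
          then have "\<bar>p k - (real k / real N) ^ j\<bar> \<le> real j * real j / (real N - real j)"
            unfolding p_def using n by (intro falling_ratio_approx) (auto simp: N_def)
          then show "norm (w N k * ((real k / real N) ^ j - p k)) \<le>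
              w N k * (real j * real j / (real N - real j))"
            using mult_left_mono[OF _ w[of N k]] w[of N k]
            by (simp add: abs_mult abs_minus_commute del: times_divide_eq_right)
        qed
        also have "\<dots> = real j * real j / (real N - real j)"
          by (simp only: w_sum mult_1 flip: sum_distrib_right)
        finally show "norm (integral\<^sup>L (\<mu> n) (\<lambda>x. clamp01 x ^ j) - a j)
            \<le> real j * real j / (real (Suc n) - real j)" by (simp add: N_def)
      qed
    qed simp
    then have "(\<lambda>n. integral\<^sup>L ((\<mu> \<circ> r) n) (\<lambda>x. clamp01 x ^ j)) \<longlonglongrightarrow> a j"
      using LIMSEQ_subseq_LIMSEQ[OF _ r, of "\<lambda>n. integral\<^sup>L (\<mu> n) (\<lambda>x. clamp01 x ^ j)" "a j"]
      by (simp add: comp_def)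
    ultimately show ?thesis by (rule LIMSEQ_unique)
  qed
  \<comment> \<open>The image under \<open>clamp01\<close> lies in [0,1] by construction and has the
    integrals in \<open>mom\<close> as its moments.\<close>
  have "real_distribution (distr M borel clamp01)"
    by (intro M.real_distribution_distr) simp
  moreover have "AE x in distr M borel clamp01. 0 \<le> x \<and> x \<le> 1"
    by (subst AE_distr_iff) (auto simp: clamp01_bounds)
  moreover have "(\<integral>x. x ^ j \<partial>distr M borel clamp01) = a j" for j
    by (subst integral_distr) (auto simp: mom)
  ultimately show ?thesis by blast
qed

text \<open>Measures on [0,1] are kept on the Borel sets of the whole line, the setting of
  \<open>real_distribution\<close> and of characteristic functions.\<close>

definition unit_finite_measure :: "real measure \<Rightarrow> bool" where
  "unit_finite_measure M \<longleftrightarrow> finite_measure M \<and> sets M = sets borel \<and> (AE x in M. 0 \<le> x \<and> x \<le> 1)"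

text \<open>Division by \<open>a 0\<close> reduces to the probability case. If
  \<open>a 0 = 0\<close>, the sequence is nonnegative and nonincreasing, hence zero, and the null
  measure represents it.\<close>

lemma hausdorff_moment_existence:
  assumes pos: "\<And>n k. bdiff 1 n a k \<ge> (0::real)"
  shows "\<exists>M. unit_finite_measure M \<and> (\<forall>j. (\<integral>x. x ^ j \<partial>M) = a j)"
proof (cases "a 0 = 0")
  case True
  have "a (Suc k) \<le> a k" "a k \<ge> 0" for k using pos[of 1 k] pos[of 0 k] by auto
  then have "a k = 0" for k
    by (induction k) (use True in \<open>auto intro: antisym\<close>, metis order_antisym)
  then show ?thesis
    by (intro exI[of _ "null_measure borel"])
       (auto simp: unit_finite_measure_def intro!: finite_measureI AE_I[of _ _ UNIV])
next
  case False
  with pos[of 0 0] have a0: "a 0 > 0" by simp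
  have "bdiff 1 n (\<lambda>k. a k / a 0) k = bdiff 1 n a k / a 0" for n k
    by (induction n arbitrary: k) (auto simp: diff_divide_distrib)
  then obtain M where M: "real_distribution M" "AE x in M. 0 \<le> x \<and> x \<le> 1"
    and mom: "\<And>j. (\<integral>x. x ^ j \<partial>M) = a j / a 0"
    using hausdorff_probability[of "\<lambda>k. a k / a 0"] pos a0 by auto
  interpret M: real_distribution M by fact
  define M' where "M' = density M (\<lambda>_. ennreal (a 0))"
  have "finite_measure M'"
    by (rule finite_measureI) (simp add: M'_def emeasure_density nn_integral_cmult M.emeasure_space_1[simplified] ennreal_mult_eq_top_iff)
  moreover have "AE x in M'. 0 \<le> x \<and> x \<le> 1"
    unfolding M'_def by (subst AE_density) (use M(2) in auto)
  moreover have "(\<integral>x. x ^ j \<partial>M') = a j" for j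
    unfolding M'_def by (subst integral_density) (use a0 in \<open>auto simp: mom\<close>)
  moreover have "sets M' = sets borel" by (simp add: M'_def)
  ultimately show ?thesis unfolding unit_finite_measure_def by blast
qed

lemma unit_finite_measure_integrable:
  fixes f :: "real \<Rightarrow> 'a::{banach, second_countable_topology}"
  assumes M: "unit_finite_measure M" and f: "f \<in> borel_measurable borel"
    and bdd: "\<And>x. 0 \<le> x \<Longrightarrow> x \<le> 1 \<Longrightarrow> norm (f x) \<le> B"
  shows "integrable M f"
proof -
  interpret finite_measure M using M by (simp add: unit_finite_measure_def)
  have "f \<in> borel_measurable M"
    using f measurable_cong_sets[of M borel borel borel] M unfolding unit_finite_measure_def by metis
  moreover have "AE x in M. 0 \<le> x \<and> x \<le> 1"
    using M by (simp add: unit_finite_measure_def)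
  then have "AE x in M. norm (f x) \<le> B"
    by (rule eventually_mono) (auto intro: bdd)
  ultimately show ?thesis by (rule integrable_const_bound[rotated])
qed

section \<open>Moments determine a finite measure on the unit interval\<close>

text \<open>Integrals of the truncated exponential series depend on the moments only. On [0,1] the
  truncations are dominated by \<open>exp \<bar>t\<bar>\<close>, so these integrals converge to the
  characteristic function.\<close>

lemma moment_uniqueness_distribution:
  assumes M: "real_distribution M" "AE x in M. 0 \<le> x \<and> x \<le> 1"
    and N: "real_distribution N" "AE x in N. 0 \<le> x \<and> x \<le> 1"
    and mom: "\<And>j. (\<integral>x. x ^ j \<partial>M) = (\<integral>x. x ^ j \<partial>N)"
  shows "M = N"
proof (rule Levy_uniqueness[OF M(1) N(1)])
  define S where "S t n x = (\<Sum>k<n. (\<i> * complex_of_real (t * x)) ^ k /\<^sub>R fact k)" for t x and n :: nat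
  have lim: "(\<lambda>n. \<integral>x. S t n x \<partial>P) \<longlonglongrightarrow> char P t"
    if P: "real_distribution P" "AE x in P. 0 \<le> x \<and> x \<le> 1" for P t
    unfolding char_def
  proof (rule integral_dominated_convergence)
    interpret real_distribution P by fact
    show "S t n \<in> borel_measurable P" for n
      unfolding S_def by measurable
    show "(\<lambda>x. iexp (t * x)) \<in> borel_measurable P" by measurable
    show "integrable P (\<lambda>_. exp \<bar>t\<bar>)" by simp
    show "AE x in P. (\<lambda>n. S t n x) \<longlonglongrightarrow> iexp (t * x)"
      unfolding S_def using exp_converges[of "\<i> * complex_of_real (t * _)"]
      by (auto simp: sums_def)
    show "AE x in P. norm (S t n x) \<le> exp \<bar>t\<bar>" for n
      using P(2)
    proof eventually_elim
      fix x :: real assume x: "0 \<le> x \<and> x \<le> 1"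
      have "norm (S t n x) \<le> (\<Sum>k<n. \<bar>t\<bar> ^ k /\<^sub>R fact k)"
        unfolding S_def
      proof (rule sum_norm_le)
        fix k
        have "\<bar>t\<bar> * \<bar>x\<bar> \<le> \<bar>t\<bar> * 1" using x by (intro mult_left_mono) auto
        then have "(\<bar>t\<bar> * \<bar>x\<bar>) ^ k \<le> \<bar>t\<bar> ^ k" by (intro power_mono) auto
        then show "norm ((\<i> * complex_of_real (t * x)) ^ k /\<^sub>R fact k) \<le> \<bar>t\<bar> ^ k /\<^sub>R fact k"
          by (simp add: norm_mult norm_power abs_mult field_simps del: of_real_mult)
      qed
      also have "\<dots> \<le> exp \<bar>t\<bar>"
        unfolding exp_def by (rule sum_le_suminf[OF summable_exp_generic]) auto
      finally show "norm (S t n x) \<le> exp \<bar>t\<bar>" .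
    qed
  qed
  have S_int: "(\<integral>x. S t n x \<partial>P) = (\<Sum>k<n. (\<i> * complex_of_real t) ^ k * complex_of_real (\<integral>x. x ^ k \<partial>P) /\<^sub>R fact k)"
    if P: "real_distribution P" "AE x in P. 0 \<le> x \<and> x \<le> 1" for P t n
  proof -
    interpret real_distribution P by fact
    have bdd: "AE x in P. norm (complex_of_real (x ^ k)) \<le> 1" for k
      using P(2) by eventually_elim (simp add: norm_power power_le_one)
    have int: "integrable P (\<lambda>x. complex_of_real (x ^ k))" for k
      by (rule integrable_const_bound[OF bdd]) simp
    have "(\<integral>x. S t n x \<partial>P) = (\<integral>x. (\<Sum>k<n. ((\<i> * complex_of_real t) ^ k /\<^sub>R fact k) * complex_of_real (x ^ k)) \<partial>P)"
      by (simp add: S_def power_mult_distrib mult.assoc)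
    also have "\<dots> = (\<Sum>k<n. ((\<i> * complex_of_real t) ^ k /\<^sub>R fact k) * (\<integral>x. complex_of_real (x ^ k) \<partial>P))"
      using int by (subst Bochner_Integration.integral_sum) (auto intro!: integrable_mult_right simp del: of_real_power)
    finally show ?thesis by (simp del: of_real_power)
  qed
  show "char M = char N"
  proof
    fix t
    show "char M t = char N t"
      using lim[OF M, of t] lim[OF N, of t]
      unfolding S_int[OF M] S_int[OF N] mom by (rule LIMSEQ_unique)
  qed
qed

lemma moment_uniqueness:
  assumes M: "unit_finite_measure M" and N: "unit_finite_measure N"
    and mom: "\<And>j. (\<integral>x. x ^ j \<partial>M) = (\<integral>x. x ^ j \<partial>N)"
  shows "M = N"
proof -
  have sets: "sets M = sets borel" "sets N = sets borel"
    using M N by (auto simp: unit_finite_measure_def)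
  interpret M: finite_measure M using M by (simp add: unit_finite_measure_def)
  interpret N: finite_measure N using N by (simp add: unit_finite_measure_def)
  define m where "m = measure M (space M)"
  have m: "m = measure N (space N)" using mom[of 0] by (simp add: m_def)
  show ?thesis
  proof (cases "m = 0")
    case True
    then have null: "emeasure M (space M) = 0" "emeasure N (space N) = 0"
      using m by (auto simp: m_def M.emeasure_eq_measure N.emeasure_eq_measure)
    show ?thesis
    proof (rule measure_eqI)
      fix A assume "A \<in> sets M"
      show "emeasure M A = emeasure N A"
        using null emeasure_space[of M A] emeasure_space[of N A] by simp
    qed (simp add: sets)
  next
    case False
    then have m_pos: "m > 0" by (simp add: m_def zero_less_measure_iff)
    have norm: "real_distribution (density P (\<lambda>_. ennreal (1 / m)))"
        "AE x in density P (\<lambda>_. ennreal (1 / m)). 0 \<le> x \<and> x \<le> 1"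
        "(\<integral>x. x ^ j \<partial>density P (\<lambda>_. ennreal (1 / m))) = (\<integral>x. x ^ j \<partial>P) / m"
      if P: "unit_finite_measure P" "m = measure P (space P)" for P j
    proof -
      have sets[measurable_cong]: "sets P = sets borel" using P by (simp add: unit_finite_measure_def)
      have space: "space P = UNIV" using sets_eq_imp_space_eq[OF sets] by simp
      interpret P: finite_measure P using P by (simp add: unit_finite_measure_def)
      have "emeasure P UNIV = ennreal m" using P(2) by (simp add: P.emeasure_eq_measure space)
      then have "prob_space (density P (\<lambda>_. ennreal (1 / m)))"
        using m_pos by (intro prob_spaceI)
          (simp add: emeasure_density space sets flip: ennreal_mult')
      then show "real_distribution (density P (\<lambda>_. ennreal (1 / m)))"
        by (simp add: real_distribution_def real_distribution_axioms_def sets)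
      show "AE x in density P (\<lambda>_. ennreal (1 / m)). 0 \<le> x \<and> x \<le> 1"
        using P(1) by (subst AE_density) (auto simp: unit_finite_measure_def)
      show "(\<integral>x. x ^ j \<partial>density P (\<lambda>_. ennreal (1 / m))) = (\<integral>x. x ^ j \<partial>P) / m"
        using m_pos by (subst integral_density) auto
    qed
    have eq: "density M (\<lambda>_. ennreal (1 / m)) = density N (\<lambda>_. ennreal (1 / m))"
      using norm[OF M m_def] norm[OF N m] by (intro moment_uniqueness_distribution) (auto simp: mom)
    have recover: "P = density (density P (\<lambda>_. ennreal (1 / m))) (\<lambda>_. ennreal m)"
      if "sets P = sets borel" for P :: "real measure"
    proof -
      have "density (density P (\<lambda>_. ennreal (1 / m))) (\<lambda>_. ennreal m) = density P (\<lambda>_. 1)"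
        using m_pos by (subst density_density_eq) (auto simp flip: ennreal_mult')
      then show ?thesis by (simp add: density_1)
    qed
    show ?thesis
      using recover[OF sets(1)] recover[OF sets(2)] eq by simp
  qed
qed

section \<open>Uniqueness of the representation\<close>

text \<open>The inverse of \<open>l \<mapsto> exp (- l)\<close> on (0,1). The value 1 elsewhere
  keeps the range in the open half-line, so the map is measurable into the restricted space.\<close>

definition log_coord :: "real \<Rightarrow> real" where
  "log_coord y = (if 0 < y \<and> y < 1 then - ln y else 1)"

lemma borel_measurable_log_coord [measurable]: "log_coord \<in> borel_measurable borel"
  unfolding log_coord_def by measurable

lemma measurable_log_coord: "log_coord \<in> borel \<rightarrow>\<^sub>M restrict_space borel {0<..}"
  by (rule measurable_restrict_space2) (auto simp: log_coord_def)

lemma log_coord_exp: "l > 0 \<Longrightarrow> log_coord (exp (- l)) = l"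
  by (simp add: log_coord_def)

context levy_measure
begin

text \<open>The weight is at most \<open>min 1 l\<close>, which makes the image finite; its moments
  are the unit increments of \<open>levy_integral\<close>.\<close>

definition exp_image :: "real measure" where
  "exp_image = distr (density \<mu> (\<lambda>l. ennreal (1 - exp (- l)))) borel (\<lambda>l. exp (- l))"

lemma sets_exp_image: "sets exp_image = sets borel"
  by (simp add: exp_image_def)

lemma one_minus_exp_measurable: "(\<lambda>l. ennreal (1 - exp (- l))) \<in> borel_measurable \<mu>"
  by (intro measurable_compose[OF measurable_levy measurable_ennreal]) simp

lemma exp_measurable: "(\<lambda>l. exp (- l)) \<in> \<mu> \<rightarrow>\<^sub>M (borel :: real measure)"
  by (rule measurable_levy) simp

lemma unit_finite_measure_exp_image: "unit_finite_measure exp_image"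
  unfolding unit_finite_measure_def
proof (intro conjI)
  have "emeasure exp_image (space exp_image) = (\<integral>\<^sup>+ l. ennreal (1 - exp (- l)) \<partial>\<mu>)"
    unfolding exp_image_def
    by (subst emeasure_distr)
       (auto simp: exp_measurable emeasure_density one_minus_exp_measurable intro!: nn_integral_cong)
  also have "\<dots> \<le> (\<integral>\<^sup>+ l. ennreal (min 1 l) \<partial>\<mu>)"
  proof (rule nn_integral_mono)
    fix l show "ennreal (1 - exp (- l)) \<le> ennreal (min 1 l)"
      using exp_ge_add_one_self[of "- l"] by (intro ennreal_leI) (simp add: min_def)
  qed
  also have "\<dots> < \<infinity>" by (rule nn_integral_min)
  finally show "finite_measure exp_image" by (intro finite_measureI) simp
  show "AE x in exp_image. 0 \<le> x \<and> x \<le> 1"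
    unfolding exp_image_def
    by (subst AE_distr_iff, simp add: exp_measurable, simp, subst AE_density)
       (auto intro!: AE_I2 simp: one_minus_exp_measurable space_levy)
qed (rule sets_exp_image)

lemma exp_image_moment:
  "(\<integral>x. x ^ j \<partial>exp_image) = levy_integral (real j + 1) - levy_integral (real j)"
proof -
  have "(\<integral>x. x ^ j \<partial>exp_image) = (\<integral>l. exp (- l) ^ j \<partial>density \<mu> (\<lambda>l. ennreal (1 - exp (- l))))"
    unfolding exp_image_def by (subst integral_distr) (simp_all add: exp_measurable)
  also have "\<dots> = (\<integral>l. (1 - exp (- l)) *\<^sub>R exp (- l) ^ j \<partial>\<mu>)"
    by (subst integral_density) (auto intro!: measurable_levy AE_I2 simp: space_levy)
  also have "\<dots> = levy_integral (real j + 1) - levy_integral (real j)"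
    by (simp add: exp_diff_kernel_integrable(2) mult.commute flip: exp_of_nat_mult)
  finally show ?thesis .
qed

text \<open>\<open>log_coord\<close> undoes the substitution, and the weight can be divided out
  since it is positive on the open half-line. Thus the moments of \<open>exp_image\<close> determine
  \<open>\<mu>\<close>.\<close>

lemma levy_measure_from_exp_image:
  "\<mu> = density (distr exp_image (restrict_space borel {0<..}) log_coord) (\<lambda>l. ennreal (1 / (1 - exp (- l))))"
proof -
  define w where "w l = ennreal (1 - exp (- l))" for l :: real
  have w: "w \<in> borel_measurable \<mu>" unfolding w_def by (rule one_minus_exp_measurable)
  have log_coord_meas: "log_coord \<in> borel \<rightarrow>\<^sub>M \<mu>"
    using measurable_log_coord unfolding measurable_cong_sets[OF refl sets_levy] .
  have "distr exp_image (restrict_space borel {0<..}) log_coord =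
      distr (density \<mu> w) (restrict_space borel {0<..}) (log_coord \<circ> (\<lambda>l. exp (- l)))"
    unfolding exp_image_def w_def by (rule distr_distr) (simp_all add: exp_measurable measurable_log_coord)
  also have "\<dots> = distr (density \<mu> w) (density \<mu> w) (\<lambda>l. l)"
    by (rule distr_cong) (auto simp: sets_levy space_levy log_coord_exp)
  also have "\<dots> = density \<mu> w" by simp
  finally have "density (distr exp_image (restrict_space borel {0<..}) log_coord) (\<lambda>l. ennreal (1 / (1 - exp (- l)))) =
      density (density \<mu> w) (\<lambda>l. ennreal (1 / (1 - exp (- l))))" by simp
  also have "\<dots> = density \<mu> (\<lambda>l. w l * ennreal (1 / (1 - exp (- l))))"
    by (rule density_density_eq[OF w]) (intro measurable_compose[OF measurable_levy measurable_ennreal], simp)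
  also have "\<dots> = density \<mu> (\<lambda>l. 1)"
  proof (rule density_cong)
    show "AE l in \<mu>. w l * ennreal (1 / (1 - exp (- l))) = 1"
      by (rule AE_I2) (simp add: w_def space_levy flip: ennreal_mult)
  qed (auto intro!: borel_measurable_times_ennreal w measurable_compose[OF measurable_levy measurable_ennreal])
  finally show ?thesis by (simp add: density_1)
qed

end

lemma levy_khintchine_unique:
  assumes rep: "levy_khintchine_rep \<psi> a b \<mu>" and rep': "levy_khintchine_rep \<psi> a' b' \<mu>'"
  shows "a = a' \<and> b = b' \<and> \<mu> = \<mu>'"
proof -
  interpret L: levy_measure \<mu> using rep by (simp add: levy_khintchine_rep_iff)
  interpret L': levy_measure \<mu>' using rep' by (simp add: levy_khintchine_rep_iff)
  have \<psi>: "\<psi> t = a + b * \<bar>t\<bar> + L.levy_integral \<bar>t\<bar>" for t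
    using rep by (simp add: levy_khintchine_rep_iff)
  have \<psi>': "\<psi> t = a' + b' * \<bar>t\<bar> + L'.levy_integral \<bar>t\<bar>" for t
    using rep' by (simp add: levy_khintchine_rep_iff)
  define g where "g n = \<psi> (real n + 1) - \<psi> (real n)" for n
  have g: "g n = b + (L.levy_integral (real n + 1) - L.levy_integral (real n))" for n
    by (simp add: g_def \<psi> algebra_simps)
  have g': "g n = b' + (L'.levy_integral (real n + 1) - L'.levy_integral (real n))" for n
    by (simp add: g_def \<psi>' algebra_simps)
  have "a = a'"
    using \<psi>[of 0] \<psi>'[of 0] by (simp add: L.levy_integral_0 L'.levy_integral_0)
  have "g \<longlonglongrightarrow> b"
    using tendsto_add[OF tendsto_const[of b] L.levy_integral_increment_tendsto_0] by (simp flip: g)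
  moreover have "g \<longlonglongrightarrow> b'"
    using tendsto_add[OF tendsto_const[of b'] L'.levy_integral_increment_tendsto_0] by (simp flip: g')
  ultimately have b: "b = b'" by (auto intro: LIMSEQ_unique)
  \<comment> \<open>The slopes being equal, the moment of order \<open>j\<close> of either image is
    \<open>g j - b\<close>.\<close>
  have "L.exp_image = L'.exp_image"
  proof (rule moment_uniqueness)
    show "(\<integral>x. x ^ j \<partial>L.exp_image) = (\<integral>x. x ^ j \<partial>L'.exp_image)" for j
      using g[of j] g'[of j] b by (simp add: L.exp_image_moment L'.exp_image_moment)
  qed (rule L.unit_finite_measure_exp_image L'.unit_finite_measure_exp_image)+
  then have "\<mu> = \<mu>'"
    using L.levy_measure_from_exp_image L'.levy_measure_from_exp_image by simp
  with \<open>a = a'\<close> b show ?thesis by blast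
qed

section \<open>Existence of the representation\<close>

text \<open>Subtract the chord and take the leftmost minimum point \<open>p\<close>. If the minimum
  were negative, \<open>p\<close> would be interior, and the midpoint inequality would fail on an
  interval centred at \<open>p\<close>, whose left end has a strictly larger value.\<close>

lemma midpoint_concave_imp_concave:
  fixes f :: "real \<Rightarrow> real"
  assumes cont: "continuous_on {x..y} f"
    and mid: "\<And>t h. x \<le> t \<Longrightarrow> h > 0 \<Longrightarrow> t + 2 * h \<le> y \<Longrightarrow> f t + f (t + 2 * h) \<le> 2 * f (t + h)"
    and z: "x \<le> z" "z \<le> y"
  shows "(y - z) * f x + (z - x) * f y \<le> (y - x) * f z"
proof -
  define \<phi> where "\<phi> u = (y - x) * f u - (y - u) * f x - (u - x) * f y" for u
  have ends: "\<phi> x = 0" "\<phi> y = 0" by (simp_all add: \<phi>_def algebra_simps)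
  have cont_\<phi>: "continuous_on {x..y} \<phi>"
    unfolding \<phi>_def by (intro continuous_intros cont)
  have mid_\<phi>: "\<phi> t + \<phi> (t + 2 * h) \<le> 2 * \<phi> (t + h)" if "x \<le> t" "h > 0" "t + 2 * h \<le> y" for t h
    using mult_left_mono[OF mid[OF that], of "y - x"] that by (simp add: \<phi>_def algebra_simps)
  obtain m where m: "m \<in> {x..y}" "\<And>u. u \<in> {x..y} \<Longrightarrow> \<phi> m \<le> \<phi> u"
    using continuous_attains_inf[OF compact_Icc _ cont_\<phi>] z by auto
  define S where "S = {u \<in> {x..y}. \<phi> u = \<phi> m}"
  have "closed S" unfolding S_def
    using continuous_closed_preimage_constant[OF cont_\<phi> closed_atLeastAtMost] .
  then have "compact S"
    using compact_Int_closed[of "{x..y}" S] by (auto simp: S_def Int_absorb1 subset_eq)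
  then obtain p where p: "p \<in> S" "\<And>u. u \<in> S \<Longrightarrow> p \<le> u"
    using compact_attains_inf[of S] m by (auto simp: S_def)
  have "\<phi> m \<ge> 0"
  proof (rule ccontr)
    assume neg: "\<not> \<phi> m \<ge> 0"
    then have "p \<noteq> x" "p \<noteq> y" using p(1) ends by (auto simp: S_def)
    then have xy: "x < p" "p < y" using p(1) by (auto simp: S_def)
    define h where "h = min (p - x) (y - p)"
    have h: "h > 0" "x \<le> p - h" "p + h \<le> y" using xy by (auto simp: h_def)
    have "\<phi> (p - h) + \<phi> (p + h) \<le> 2 * \<phi> p"
      using mid_\<phi>[of "p - h" h] h by (simp add: add.commute)
    moreover have "\<phi> (p - h) > \<phi> m"
      using m(2)[of "p - h"] p(2)[of "p - h"] h xy by (force simp: S_def)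
    moreover have "\<phi> (p + h) \<ge> \<phi> m" using m(2)[of "p + h"] h xy by simp
    ultimately show False using p(1) by (simp add: S_def)
  qed
  with m(2)[of z] z have "\<phi> z \<ge> 0" by simp
  then show ?thesis by (simp add: \<phi>_def)
qed

text \<open>A unit increment telescopes into \<open>m\<close> steps of length \<open>1 / m\<close>,
  so its difference of order \<open>n\<close> is a sum of differences of \<open>f\<close> of order
  \<open>n + 1\<close>, with opposite sign.\<close>

lemma increment_bdiff_nonneg:
  fixes f :: "real \<Rightarrow> real"
  assumes D: "\<And>t. t \<ge> 0 \<Longrightarrow> bdiff (1 / real m) (Suc n) f t \<le> 0" and m: "m > 0" and t: "t \<ge> 0"
  shows "bdiff (1 / real m) n (\<lambda>t. f (t + 1) - f t) t \<ge> 0"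
proof -
  define h where "h = 1 / real m"
  have tele: "f (t + 1) - f t = (\<Sum>i<m. - bdiff h 1 f (real i * h + t))" for t
  proof -
    have "(\<Sum>i<m. - bdiff h 1 f (real i * h + t)) = (\<Sum>i<m. f (real (Suc i) * h + t) - f (real i * h + t))"
      by (simp add: algebra_simps)
    also have "\<dots> = f (real m * h + t) - f (real 0 * h + t)"
      by (rule sum_lessThan_telescope)
    finally show ?thesis using m by (simp add: h_def add.commute)
  qed
  have "bdiff h n (\<lambda>t. f (t + 1) - f t) t = (\<Sum>i<m. bdiff h n (\<lambda>u. - bdiff h 1 f u) (real i * h + t))"
    unfolding tele by (rule bdiff_sum_shift[where a = "\<lambda>i. real i * h"]) (rule add.commute)
  also have "\<dots> = (\<Sum>i<m. - bdiff h (Suc n) f (real i * h + t))"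
    using bdiff_add[of h n 1 f] by (simp only: bdiff_uminus) (simp del: bdiff.simps)
  also have "\<dots> \<ge> 0"
    by (rule sum_nonneg) (use D t in \<open>simp add: h_def del: bdiff.simps\<close>)
  finally show ?thesis unfolding h_def .
qed

text \<open>
  Junk value: \<open>0 powr 0 = 0\<close>, so at \<open>t = 0\<close> an atom of \<open>\<nu>\<close> at 0 does not contribute.
\<close>

lemma bernstein_hausdorff_representation:
  fixes g :: "real \<Rightarrow> real"
  assumes cont: "continuous_on UNIV g"
    and pos: "\<And>m n t. m > 0 \<Longrightarrow> t \<ge> 0 \<Longrightarrow> bdiff (1 / real m) n g t \<ge> 0"
  obtains \<nu> where "unit_finite_measure \<nu>" "\<And>t. t \<ge> 0 \<Longrightarrow> g t = (\<integral>y. y powr t \<partial>\<nu>)"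
proof -
  have ex: "\<exists>\<nu>. unit_finite_measure \<nu> \<and> (\<forall>k. (\<integral>x. x ^ k \<partial>\<nu>) = g (real k * (1 / real m)))" if "m > 0" for m
    by (rule hausdorff_moment_existence) (unfold bdiff_grid, rule pos, use that in auto)
  obtain \<nu> where \<nu>: "unit_finite_measure \<nu>" and mom: "\<And>k. (\<integral>x. x ^ k \<partial>\<nu>) = g (real k)"
    using ex[of 1] by auto
  \<comment> \<open>Here \<open>k = 0\<close> is excluded because \<open>0 powr 0\<close> and
    \<open>0 ^ 0\<close> differ; \<open>t = 0\<close> is reached as a limit.\<close>
  have grid: "g (real k * (1 / real m)) = (\<integral>y. y powr (real k * (1 / real m)) \<partial>\<nu>)"
    if m: "m > 0" and k: "k > 0" for k m
  proof -
    obtain \<nu>' where \<nu>': "unit_finite_measure \<nu>'"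
      and mom': "\<And>k. (\<integral>x. x ^ k \<partial>\<nu>') = g (real k * (1 / real m))"
      using ex[OF m] by blast
    interpret \<nu>': finite_measure \<nu>' using \<nu>' by (simp add: unit_finite_measure_def)
    have [measurable_cong]: "sets \<nu>' = sets borel" and AE': "AE x in \<nu>'. 0 \<le> x \<and> x \<le> 1"
      using \<nu>' by (simp_all only: unit_finite_measure_def)
    have AE_pow: "AE x in \<nu>'. 0 \<le> x ^ m \<and> x ^ m \<le> 1"
      using AE' by eventually_elim (auto simp: power_le_one)
    \<comment> \<open>The image under \<open>x ^ m\<close> of the measure for mesh
      \<open>1 / m\<close> has the integer moments of \<open>\<nu>\<close>, so the two coincide and
      all grids share one measure.\<close>
    have "unit_finite_measure (distr \<nu>' borel (\<lambda>x. x ^ m))"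
      unfolding unit_finite_measure_def
    proof (intro conjI)
      show "finite_measure (distr \<nu>' borel (\<lambda>x. x ^ m))"
        by (rule \<nu>'.finite_measure_distr) measurable
      show "AE x in distr \<nu>' borel (\<lambda>x. x ^ m). 0 \<le> x \<and> x \<le> 1"
        using AE_pow by (subst AE_distr_iff) auto
    qed simp
    moreover have "(\<integral>x. x ^ j \<partial>distr \<nu>' borel (\<lambda>x. x ^ m)) = (\<integral>x. x ^ j \<partial>\<nu>)" for j
    proof -
      have "(\<integral>x. x ^ j \<partial>distr \<nu>' borel (\<lambda>x. x ^ m)) = (\<integral>x. x ^ (m * j) \<partial>\<nu>')"
        by (subst integral_distr) (simp_all add: power_mult)
      also have "\<dots> = g (real j)" using m by (simp add: mom')
      finally show ?thesis by (simp add: mom)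
    qed
    ultimately have \<nu>_eq: "\<nu> = distr \<nu>' borel (\<lambda>x. x ^ m)"
      using \<nu> by (intro moment_uniqueness[symmetric])
    have "(\<integral>y. y powr (real k * (1 / real m)) \<partial>\<nu>) = (\<integral>x. (x ^ m) powr (real k * (1 / real m)) \<partial>\<nu>')"
      unfolding \<nu>_eq by (subst integral_distr) simp_all
    also have "\<dots> = (\<integral>x. x ^ k \<partial>\<nu>')"
    proof (rule integral_cong_AE)
      show "AE x in \<nu>'. (x ^ m) powr (real k * (1 / real m)) = x ^ k"
        using AE'
      proof eventually_elim
        fix x :: real assume x: "0 \<le> x \<and> x \<le> 1"
        show "(x ^ m) powr (real k * (1 / real m)) = x ^ k"
        proof (cases "x = 0")
          case False
          with x have "x > 0" by simp
          then have "(x ^ m) powr (real k * (1 / real m)) = x powr real k"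
            using m by (simp add: powr_powr flip: powr_realpow)
          then show ?thesis using \<open>x > 0\<close> by (simp add: powr_realpow)
        qed (use m k in \<open>simp add: zero_power\<close>)
      qed
    qed simp_all
    finally show ?thesis by (simp add: mom')
  qed
  have "g t = (\<integral>y. y powr t \<partial>\<nu>)" if t: "t \<ge> 0" for t
  proof -
    \<comment> \<open>Fractions approaching \<open>t\<close> from above; the added 1 keeps the
      numerator positive, as \<open>grid\<close> demands, also at \<open>t = 0\<close>.\<close>
    define k where "k n = nat \<lfloor>real (Suc n) * t\<rfloor> + 1" for n
    define r where "r n = real (k n) * (1 / real (Suc n))" for n
    have r_pos: "r n > 0" for n by (simp add: r_def k_def)
    have r_lim: "r \<longlonglongrightarrow> t"
    proof (rule tendsto_sandwich)
      have k: "real (Suc n) * t \<le> real (k n)" "real (k n) \<le> real (Suc n) * t + 1" for n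
      proof -
        have "real (Suc n) * t \<ge> 0" using t by simp
        then have "real (k n) = of_int \<lfloor>real (Suc n) * t\<rfloor> + 1"
          unfolding k_def of_nat_add by simp
        then show "real (Suc n) * t \<le> real (k n)" "real (k n) \<le> real (Suc n) * t + 1"
          by linarith+
      qed
      have "t \<le> r n" "r n \<le> t + 1 / real (Suc n)" for n
        using k[of n] by (simp_all add: r_def pos_le_divide_eq pos_divide_le_eq distrib_left mult.commute
          flip: add_divide_distrib del: of_nat_Suc)
      then show "\<forall>\<^sub>F n in sequentially. t \<le> r n"
        "\<forall>\<^sub>F n in sequentially. r n \<le> t + 1 / real (Suc n)" by simp_all
      show "(\<lambda>n. t + 1 / real (Suc n)) \<longlonglongrightarrow> t" by real_asymp
    qed simp
    have sets: "sets \<nu> = sets borel" and AE: "AE x in \<nu>. 0 \<le> x \<and> x \<le> 1"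
      using \<nu> by (simp_all only: unit_finite_measure_def)
    note [measurable_cong] = sets
    have "(\<lambda>n. g (r n)) \<longlonglongrightarrow> g t"
      using cont r_lim by (auto simp: continuous_on_eq_continuous_at isCont_tendsto_compose)
    moreover have "(\<lambda>n. \<integral>y. y powr r n \<partial>\<nu>) \<longlonglongrightarrow> (\<integral>y. y powr t \<partial>\<nu>)"
    proof (rule integral_dominated_convergence)
      show "integrable \<nu> (\<lambda>_. 1 :: real)"
        by (rule unit_finite_measure_integrable[OF \<nu>]) auto
      show "AE y in \<nu>. (\<lambda>n. y powr r n) \<longlonglongrightarrow> y powr t"
      proof (rule AE_I2)
        fix y :: real
        show "(\<lambda>n. y powr r n) \<longlonglongrightarrow> y powr t"
          by (cases "y = 0") (auto intro!: tendsto_powr r_lim)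
      qed
      show "AE y in \<nu>. norm (y powr r n) \<le> 1" for n
        using AE by eventually_elim (use r_pos[of n] in \<open>auto intro: powr_le1\<close>)
    qed measurable
    moreover have "g (r n) = (\<integral>y. y powr r n \<partial>\<nu>)" for n
      unfolding r_def by (rule grid) (simp_all add: k_def)
    ultimately show ?thesis by (simp add: LIMSEQ_unique)
  qed
  with \<nu> that show ?thesis by blast
qed

section \<open>Construction of the Levy triple\<close>

lemma bdiff_nonpos_imp_levy_khintchine:
  fixes f :: "real \<Rightarrow> real"
  assumes sym: "\<And>t. f (- t) = f t" and cont: "continuous_on UNIV f" and f0: "f 0 \<ge> 0"
    and D: "\<And>n h t. n \<ge> 1 \<Longrightarrow> h > 0 \<Longrightarrow> t \<ge> 0 \<Longrightarrow> bdiff h n f t \<le> 0"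
  shows "\<exists>a b \<mu>. levy_khintchine_rep f a b \<mu>"
proof -
  define g where "g t = f (t + 1) - f t" for t
  have cont_g: "continuous_on UNIV g"
    unfolding g_def by (intro continuous_intros cont continuous_on_compose2[OF cont]) auto
  have pos_g: "bdiff (1 / real m) n g t \<ge> 0" if "m > 0" "t \<ge> 0" for m n t
    unfolding g_def by (rule increment_bdiff_nonneg) (use D that in \<open>simp_all del: bdiff.simps\<close>)
  obtain \<nu> where \<nu>: "unit_finite_measure \<nu>" and g_\<nu>: "\<And>t. t \<ge> 0 \<Longrightarrow> g t = (\<integral>y. y powr t \<partial>\<nu>)"
    using bernstein_hausdorff_representation[OF cont_g pos_g] by blast
  interpret \<nu>: finite_measure \<nu> using \<nu> by (simp add: unit_finite_measure_def)
  have sets[measurable_cong]: "sets \<nu> = sets borel" and AE: "AE x in \<nu>. 0 \<le> x \<and> x \<le> 1"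
    using \<nu> by (simp_all only: unit_finite_measure_def)
  \<comment> \<open>The cut to the open interval leaves out the atom at 1, which becomes the slope
    \<open>b\<close>.\<close>
  define w :: "real \<Rightarrow> real" where "w y = indicator {0<..<1} y / (1 - y)" for y
  have w_meas [measurable]: "w \<in> borel_measurable borel" unfolding w_def by measurable
  have w_nonneg: "w y \<ge> 0" for y by (simp add: w_def indicator_def)
  define \<mu> where "\<mu> = distr (density \<nu> (\<lambda>y. ennreal (w y))) (restrict_space borel {0<..}) log_coord"
  define b where "b = measure \<nu> {1}"

  have int_\<mu>: "(\<integral>l. \<phi> l \<partial>\<mu>) = (\<integral>y. w y * \<phi> (log_coord y) \<partial>\<nu>)"
    if \<phi>: "\<phi> \<in> borel_measurable borel" for \<phi> :: "real \<Rightarrow> real"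
  proof -
    note [measurable] = \<phi>
    have "(\<integral>l. \<phi> l \<partial>\<mu>) = (\<integral>y. \<phi> (log_coord y) \<partial>density \<nu> (\<lambda>y. ennreal (w y)))"
      unfolding \<mu>_def
      by (rule integral_distr) (simp_all add: measurable_restrict_space1 measurable_log_coord sets cong: measurable_cong_sets)
    also have "\<dots> = (\<integral>y. w y *\<^sub>R \<phi> (log_coord y) \<partial>\<nu>)"
      by (rule integral_density) (use w_nonneg in auto)
    finally show ?thesis by simp
  qed
  have "(\<integral>\<^sup>+ l. ennreal (min 1 l) \<partial>\<mu>) = (\<integral>\<^sup>+ y. ennreal (min 1 (log_coord y)) \<partial>density \<nu> (\<lambda>y. ennreal (w y)))"
    unfolding \<mu>_def by (rule nn_integral_distr) (auto intro!: measurable_restrict_space1 simp: measurable_log_coord sets cong: measurable_cong_sets)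
  also have "\<dots> = (\<integral>\<^sup>+ y. ennreal (w y) * ennreal (min 1 (log_coord y)) \<partial>\<nu>)"
    by (rule nn_integral_density) measurable
  also have "\<dots> \<le> (\<integral>\<^sup>+ y. 2 \<partial>\<nu>)"
  proof (rule nn_integral_mono)
    fix y
    \<comment> \<open>With \<open>y = exp (- l)\<close>, the inequality
      \<open>exp (- l) \<le> 1 / (1 + l)\<close> gives \<open>1 - y \<ge> l / (1 + l)\<close>, which
      is at least half of \<open>min 1 l\<close>.\<close>
    have "w y * min 1 (log_coord y) \<le> 2"
    proof (cases "0 < y \<and> y < 1")
      case True
      define l where "l = - ln y"
      have l: "l > 0" "y = exp (- l)" using True by (auto simp: l_def)
      have "inverse (exp l) \<le> inverse (1 + l)"
        using l(1) by (intro le_imp_inverse_le) auto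
      then have "y \<le> 1 / (1 + l)" by (simp add: l(2) exp_minus inverse_eq_divide)
      then have "1 - y \<ge> l / (1 + l)" using l(1) by (simp add: field_simps)
      moreover have "min 1 l \<le> 2 * (l / (1 + l))"
        using l(1) by (simp add: min_def field_simps)
      ultimately have "min 1 l \<le> 2 * (1 - y)" by simp
      then show ?thesis using True by (simp add: w_def log_coord_def l_def field_simps)
    qed (auto simp: w_def indicator_def)
    then have "ennreal (w y * min 1 (log_coord y)) \<le> ennreal 2" by (rule ennreal_leI)
    then show "ennreal (w y) * ennreal (min 1 (log_coord y)) \<le> 2"
      using w_nonneg[of y] by (simp add: ennreal_mult')
  qed
  also have "\<dots> < \<infinity>"
    by (simp add: \<nu>.emeasure_eq_measure ennreal_mult_less_top)
  finally have levy: "levy_measure \<mu>"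
    by (simp add: levy_measure_def \<mu>_def)
  interpret levy_measure \<mu> by (rule levy)

  have incr: "g t = b + (levy_integral (t + 1) - levy_integral t)" if t: "t \<ge> 0" for t
  proof -
    have int: "integrable \<nu> (\<lambda>y. indicator {0<..<1} y * y powr t)"
      by (rule unit_finite_measure_integrable[OF \<nu>, where B = 1])
         (use t in \<open>auto simp: indicator_def intro: powr_le1\<close>)
    have "levy_integral (t + 1) - levy_integral t = (\<integral>l. exp (- l * t) * (1 - exp (- l * 1)) \<partial>\<mu>)"
      using t by (intro exp_diff_kernel_integrable(2)) auto
    also have "\<dots> = (\<integral>y. w y * (exp (- log_coord y * t) * (1 - exp (- log_coord y * 1))) \<partial>\<nu>)"
      by (rule int_\<mu>) simp
    also have "\<dots> = (\<integral>y. indicator {0<..<1} y * y powr t \<partial>\<nu>)"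
      by (rule Bochner_Integration.integral_cong)
         (auto simp: w_def log_coord_def indicator_def powr_def mult.commute)
    finally have "levy_integral (t + 1) - levy_integral t + b =
        (\<integral>y. indicator {0<..<1} y * y powr t \<partial>\<nu>) + (\<integral>y. indicator {1} y \<partial>\<nu>)"
      by (simp add: b_def sets sets_eq_imp_space_eq[OF sets])
    also have "\<dots> = (\<integral>y. indicator {0<..<1} y * y powr t + indicator {1} y \<partial>\<nu>)"
      by (rule Bochner_Integration.integral_add[symmetric, OF int])
         (rule unit_finite_measure_integrable[OF \<nu>, where B = 1], auto simp: indicator_def)
    also have "\<dots> = (\<integral>y. y powr t \<partial>\<nu>)"
    proof (rule integral_cong_AE)
      \<comment> \<open>At \<open>y = 0\<close> both sides vanish by the convention for
        \<open>powr\<close>.\<close>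
      show "AE y in \<nu>. indicator {0<..<1} y * y powr t + indicator {1} y = y powr t"
        using AE by eventually_elim (auto simp: indicator_def)
    qed measurable
    finally show ?thesis using g_\<nu>[OF t] by simp
  qed
  define p where "p t = f t - f 0 - b * t - levy_integral t" for t
  have p_Suc: "p (t + 1) = p t" if "t \<ge> 0" for t
    using incr[OF that] by (simp add: p_def g_def algebra_simps)
  have p_nat: "p (real n + s) = p s" if "s \<ge> 0" for n s
  proof (induction n)
    case (Suc n)
    with p_Suc[of "real n + s"] that show ?case by (simp add: algebra_simps)
  qed simp
  have g_lim: "(\<lambda>n. g (real n)) \<longlonglongrightarrow> b"
    using tendsto_add[OF tendsto_const[of b] levy_integral_increment_tendsto_0] by (simp add: incr)
  have conc: "(y - z) * f x + (z - x) * f y \<le> (y - x) * f z" if "0 \<le> x" "x \<le> z" "z \<le> y" for x y z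
  proof (rule midpoint_concave_imp_concave[OF _ _ that(2,3)])
    show "f t + f (t + 2 * h) \<le> 2 * f (t + h)" if "x \<le> t" "h > 0" for t h
      using D[of 2 h t] that \<open>0 \<le> x\<close> by (simp add: numeral_2_eq_2 algebra_simps)
  qed (rule continuous_on_subset[OF cont], simp)
  \<comment> \<open>Periodicity lets \<open>p s\<close> be computed far out, where the increment of
    \<open>f\<close> over length \<open>s\<close> tends to \<open>s * b\<close> and that of
    \<open>levy_integral\<close> to 0.\<close>
  have p_unit: "p s = 0" if s: "0 \<le> s" "s \<le> 1" for s
  proof -
    define d where "d n = f (real n + 1 + s) - f (real n + 1)" for n
    define e where "e n = levy_integral (real n + 1 + s) - levy_integral (real n + 1)" for n
    \<comment> \<open>Concavity between \<open>n + 1\<close> and \<open>n + 2\<close> gives the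
      lower bound; comparison with the unit interval to the left of \<open>n + 1\<close> gives the
      upper one.\<close>
    have d_bounds: "s * g (real (Suc n)) \<le> d n" "d n \<le> s * g (real n)" for n
      using conc[of "real n + 1" "real n + 1 + s" "real n + 2"] conc[of "real n" "real n + 1" "real n + 1 + s"] s
      by (simp_all add: d_def g_def algebra_simps)
    have "d \<longlonglongrightarrow> s * b"
    proof (rule tendsto_sandwich)
      show "(\<lambda>n. s * g (real (Suc n))) \<longlonglongrightarrow> s * b"
        by (intro tendsto_mult_left LIMSEQ_Suc[OF g_lim])
      show "(\<lambda>n. s * g (real n)) \<longlonglongrightarrow> s * b"
        by (intro tendsto_mult_left g_lim)
    qed (use d_bounds in auto)
    moreover have "e \<longlonglongrightarrow> 0"
    proof (rule tendsto_sandwich)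
      show "\<forall>\<^sub>F n in sequentially. 0 \<le> e n"
        using levy_integral_increment_bounds(1)[OF s] by (simp add: e_def)
      have "e n \<le> levy_integral (real (Suc n) + 1) - levy_integral (real (Suc n))" for n
        using levy_integral_increment_bounds(2)[OF s, of "real (Suc n)"] by (simp add: e_def add_ac)
      then show "\<forall>\<^sub>F n in sequentially. e n \<le> levy_integral (real (Suc n) + 1) - levy_integral (real (Suc n))"
        by simp
      show "(\<lambda>n. levy_integral (real (Suc n) + 1) - levy_integral (real (Suc n))) \<longlonglongrightarrow> 0"
        by (rule LIMSEQ_Suc[OF levy_integral_increment_tendsto_0])
    qed simp
    ultimately have "(\<lambda>n. d n - b * s - e n) \<longlonglongrightarrow> s * b - b * s - 0"
      by (intro tendsto_intros)
    moreover have "d n - b * s - e n = p s" for n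
    proof -
      have "d n - b * s - e n = p (real (Suc n) + s) - p (real (Suc n) + 0)"
        by (simp add: p_def d_def e_def algebra_simps)
      also have "\<dots> = p s - p 0" unfolding p_nat[OF s(1)] p_nat[OF order_refl] ..
      finally show ?thesis by (simp add: p_def levy_integral_0)
    qed
    ultimately show ?thesis by (simp add: LIMSEQ_const_iff)
  qed
  have p_0: "p t = 0" if t: "t \<ge> 0" for t
  proof -
    define n where "n = nat \<lfloor>t\<rfloor>"
    have "real n = of_int \<lfloor>t\<rfloor>" using t by (simp add: n_def)
    then have "0 \<le> t - real n" "t - real n \<le> 1" by linarith+
    with p_nat[of "t - real n" n] p_unit[of "t - real n"] show ?thesis by simp
  qed
  have "f t = f 0 + b * \<bar>t\<bar> + levy_integral \<bar>t\<bar>" for t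
    using p_0[of "\<bar>t\<bar>"] sym[of t] by (cases "t \<ge> 0") (auto simp: p_def)
  moreover have "b \<ge> 0" by (simp add: b_def)
  ultimately have "levy_khintchine_rep f (f 0) b \<mu>"
    unfolding levy_khintchine_rep_iff using levy f0 by blast
  then show ?thesis by blast
qed

theorem theorem5p11:
  fixes \<psi> :: "real \<Rightarrow> real"
  assumes nonneg: "\<And>t. \<psi> t \<ge> 0"
    and symmetric: "\<And>t. \<psi> (- t) = \<psi> t"
    and continuous: "continuous_on UNIV \<psi>"
  shows "(reflection_negative \<psi> \<longleftrightarrow> bernstein_function \<psi>) \<and>
    (reflection_negative \<psi> \<longleftrightarrow> (\<exists>a b \<mu>. levy_khintchine_rep \<psi> a b \<mu>)) \<and>
    (\<forall>a b \<mu> a' b' \<mu>'. levy_khintchine_rep \<psi> a b \<mu> \<longrightarrow> levy_khintchine_rep \<psi> a' b' \<mu>' \<longrightarrow>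
       a = a' \<and> b = b' \<and> \<mu> = \<mu>')"
proof -
  have levy: "\<exists>a b \<mu>. levy_khintchine_rep \<psi> a b \<mu>"
    if "\<And>n h t. n \<ge> 1 \<Longrightarrow> h > 0 \<Longrightarrow> t \<ge> 0 \<Longrightarrow> bdiff h n \<psi> t \<le> 0"
    using symmetric continuous nonneg that by (rule bdiff_nonpos_imp_levy_khintchine)
  have "\<exists>a b \<mu>. levy_khintchine_rep \<psi> a b \<mu>" if "reflection_negative \<psi>"
  proof (rule levy)
    show "bdiff h n \<psi> t \<le> 0" if "n \<ge> 1" "h > 0" "t \<ge> 0" for n h t
      by (rule reflection_negative_bdiff_nonpos)
         (use nonneg that \<open>reflection_negative \<psi>\<close> in \<open>auto simp: reflection_negative_def\<close>)
  qed
  moreover have "\<exists>a b \<mu>. levy_khintchine_rep \<psi> a b \<mu>" if "bernstein_function \<psi>"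
    by (rule levy, rule bernstein_function_bdiff_nonpos[OF that continuous])
  moreover have "reflection_negative \<psi>" "bernstein_function \<psi>" if "levy_khintchine_rep \<psi> a b \<mu>" for a b \<mu>
    using levy_khintchine_imp_reflection_negative[OF that continuous] levy_khintchine_imp_bernstein[OF that] .
  ultimately show ?thesis
    using levy_khintchine_unique by blast
qed

end
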